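(* Let $\mathcal{S}$ be a simplicial category. Assume that, for every $X\in\mathcal{S}$ and $K\in\mathbf{sSet}$, a $K$-cylinder of $X$ and a $K$-path of $X$ exist. (1) For each $(X,K)\in\mathcal{S}\times\mathbf{sSet}$ fix a $K$-cylinder $(X\otimes K,\alpha_{K,X},\{\phi_{K,X,Y}\}_{Y\in\mathcal{S}})$ of $X$. Then $\phi_{K,X,Y}:\underline{\mathcal{S}}(X\otimes K,Y)\to\underline{\mathbf{sSet}}(K,\underline{\mathcal{S}}(X,Y))$ is natural in $K$, $X$ and $Y$. (2) For each $(X,K)\in\mathcal{S}\times\mathbf{sSet}$ fix a $K$-path $(X^K,\beta_{K,X},\{\psi_{K,Y,X}\}_{Y\in\mathcal{S}})$ of $X$. Then $\psi_{K,Y,X}:\underline{\mathcal{S}}(Y,X^K)\to\underline{\mathbf{sSet}}(K,\underline{\mathcal{S}}(Y,X))$ is natural in $K$, $X$ and $Y$. (3) With such choices of cylinders and paths, there are three adjunctions (for every $X\in\mathcal{S}$ in the first two, and for every $K\in\mathbf{sSet}$ in the third), the functor named first being the left adjoint: $X\otimes(-):\mathbf{sSet}\to\mathcal{S}$ and $\underline{\mathcal{S}}(X,-):\mathcal{S}\to\mathbf{sSet}$; $X^{(-)}:\mathbf{sSet}\to\mathcal{S}^{\mathrm{op}}$ and $\underline{\mathcal{S}}(-,X):\mathcal{S}^{\mathrm{op}}\to\mathbf{sSet}$; $(-)\otimes K:\mathcal{S}\to\mathcal{S}$ and $(-)^K:\mathcal{S}\to\mathcal{S}$.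
   Context: $\mathbf{sSet}$ is the category of simplicial sets, $\circ$ is ordinary composition in a category, and $\sigma^n_0:[n]\to[0]$ is the unique map in $\Delta$. Simplicial category: a category $\mathcal{S}$ equipped with: (S1) a functor $\underline{\mathcal{S}}(-,-):\mathcal{S}^{\mathrm{op}}\times\mathcal{S}\to\mathbf{sSet}$; (S2) for all $X,Y,Z\in\mathcal{S}$ a morphism of simplicial sets $\underline{\bullet}_{X,Y,Z}:\underline{\mathcal{S}}(X,Y)\times\underline{\mathcal{S}}(Y,Z)\to\underline{\mathcal{S}}(X,Z)$, written $(f,g)\mapsto g\,\underline{\bullet}_n f$ on $n$-simplices; (S3) a natural isomorphism $\widetilde{(\;)}:\mathcal{S}(-,-)\to\underline{\mathcal{S}}(-,-)_0$ of functors $\mathcal{S}^{\mathrm{op}}\times\mathcal{S}\to\mathbf{Set}$; such that (S4) $(h\,\underline{\bullet}_n g)\,\underline{\bullet}_n f=h\,\underline{\bullet}_n(g\,\underline{\bullet}_n f)$ for $f\in\underline{\mathcal{S}}(X,Y)_n$, $g\in\underline{\mathcal{S}}(Y,Z)_n$, $h\in\underline{\mathcal{S}}(Z,W)_n$; and (S5) $\underline{\mathcal{S}}(X,g)_n(f)=(\sigma^n_0)^*(\widetilde g)\,\underline{\bullet}_n f$ for $f\in\underline{\mathcal{S}}(X,Y)_n$, $g\in\mathcal{S}(Y,Z)$, and $\underline{\mathcal{S}}(f,Z)_n(g)=g\,\underline{\bullet}_n(\sigma^n_0)^*(\widetilde f)$ for $f\in\mathcal{S}(X,Y)$, $g\in\underline{\mathcal{S}}(Y,Z)_n$.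 Internal hom and evaluation: for $A,B\in\mathbf{sSet}$, $\underline{\mathbf{sSet}}(A,B)$ is the simplicial set with $\underline{\mathbf{sSet}}(A,B)_n=\mathbf{sSet}(A\times\Delta[n],B)$, where $\theta\in\Delta([m],[n])$ acts by precomposition with $\mathrm{id}_A\times\Delta[\theta]$. It is a functor in both variables: for $u\in\mathbf{sSet}(C,A)$, $\underline{\mathbf{sSet}}(u,B)_n(f)=f\circ(u\times\mathrm{id}_{\Delta[n]})$, and for $u\in\mathbf{sSet}(B,C)$, $\underline{\mathbf{sSet}}(A,u)_n(f)=u\circ f$. The map $\mathrm{ev}_{A,B}:A\times\underline{\mathbf{sSet}}(A,B)\to B$ is $(\mathrm{ev}_{A,B})_n(a,f)=f_n(a,\mathrm{id}_{[n]})$. $K$-cylinder of $X$: a triple $(X\otimes K,\alpha_{K,X},\{\phi_{K,X,Y}\}_{Y\in\mathcal{S}})$ consisting of an object $X\otimes K$ of $\mathcal{S}$, a morphism $\alpha_{K,X}:K\to\underline{\mathcal{S}}(X,X\otimes K)$ of $\mathbf{sSet}$, and, for every $Y\in\mathcal{S}$, an isomorphism $\phi_{K,X,Y}:\underline{\mathcal{S}}(X\otimes K,Y)\to\underline{\mathbf{sSet}}(K,\underline{\mathcal{S}}(X,Y))$ of $\mathbf{sSet}$ such that $\mathrm{ev}_{K,\underline{\mathcal{S}}(X,Y)}\circ(\mathrm{id}_K\times\phi_{K,X,Y})=\underline{\bullet}_{X,X\otimes K,Y}\circ(\alpha_{K,X}\times\mathrm{id}_{\underline{\mathcal{S}}(X\otimes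 K,Y)})$ as maps $K\times\underline{\mathcal{S}}(X\otimes K,Y)\to\underline{\mathcal{S}}(X,Y)$. $K$-path of $X$: a triple $(X^K,\beta_{K,X},\{\psi_{K,Y,X}\}_{Y\in\mathcal{S}})$ consisting of an object $X^K$ of $\mathcal{S}$, a morphism $\beta_{K,X}:K\to\underline{\mathcal{S}}(X^K,X)$ of $\mathbf{sSet}$, and, for every $Y\in\mathcal{S}$, an isomorphism $\psi_{K,Y,X}:\underline{\mathcal{S}}(Y,X^K)\to\underline{\mathbf{sSet}}(K,\underline{\mathcal{S}}(Y,X))$ of $\mathbf{sSet}$ such that $\mathrm{ev}_{K,\underline{\mathcal{S}}(Y,X)}\circ(\mathrm{id}_K\times\psi_{K,Y,X})=\underline{\bullet}_{Y,X^K,X}\circ(\mathrm{pr}_2,\beta_{K,X}\circ\mathrm{pr}_1)$ as maps $K\times\underline{\mathcal{S}}(Y,X^K)\to\underline{\mathcal{S}}(Y,X)$. Functoriality: once cylinders are fixed, $\otimes$ is regarded as the unique functor $\mathcal{S}\times\mathbf{sSet}\to\mathcal{S}$ that is $(X,K)\mapsto X\otimes K$ on objects and satisfies $\underline{\mathcal{S}}(X,X\otimes u)\circ\alpha_{K,X}=\alpha_{L,X}\circ u$ for $u\in\mathbf{sSet}(K,L)$ and $\underline{\mathcal{S}}(X,f\otimes K)\circ\alpha_{K,X}=\underline{\mathcal{S}}(f,Y\otimes K)\circ\alpha_{K,Y}$ for $f\in\mathcal{S}(X,Y)$; these equations determine $X\otimes u:X\otimes K\to X\otimes L$ and $f\otimes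 K:X\otimes K\to Y\otimes K$ uniquely. Once paths are fixed, $(-)^{(-)}$ is regarded as the unique functor $\mathcal{S}\times\mathbf{sSet}^{\mathrm{op}}\to\mathcal{S}$ that is $(X,K)\mapsto X^K$ on objects and satisfies $\underline{\mathcal{S}}(X^u,X)\circ\beta_{K,X}=\beta_{L,X}\circ u$ for $u\in\mathbf{sSet}(K,L)$ and $\underline{\mathcal{S}}(f^K,X)\circ\beta_{K,X}=\underline{\mathcal{S}}(Y^K,f)\circ\beta_{K,Y}$ for $f\in\mathcal{S}(Y,X)$; these equations determine $X^u:X^L\to X^K$ and $f^K:Y^K\to X^K$ uniquely. Naturality of $\phi$ and $\psi$ is with respect to these functors. *)

theory Defs
  imports "HOL-Library.FuncSet"
begin

section \<open>Categories, functors, adjunctions\<close>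

text \<open>
  Hom-sets are indexed by their source and target and need not be disjoint;
  accordingly \<open>cmp C X Y Z g f\<close> is the composite of
  \<open>f \<in> hom C X Y\<close> followed by \<open>g \<in> hom C Y Z\<close>.
\<close>

record ('o, 'm) cat =
  obj :: "'o set"
  hom :: "'o \<Rightarrow> 'o \<Rightarrow> 'm set"
  idt :: "'o \<Rightarrow> 'm"
  cmp :: "'o \<Rightarrow> 'o \<Rightarrow> 'o \<Rightarrow> 'm \<Rightarrow> 'm \<Rightarrow> 'm"

definition is_category :: "('o, 'm, 'z) cat_scheme \<Rightarrow> bool" where
  "is_category C \<longleftrightarrow>
     (\<forall>X \<in> obj C. idt C X \<in> hom C X X) \<and>
     (\<forall>X \<in> obj C. \<forall>Y \<in> obj C. \<forall>Z \<in> obj C. \<forall>f \<in> hom C X Y. \<forall>g \<in> hom C Y Z.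
        cmp C X Y Z g f \<in> hom C X Z) \<and>
     (\<forall>X \<in> obj C. \<forall>Y \<in> obj C. \<forall>f \<in> hom C X Y.
        cmp C X X Y f (idt C X) = f \<and> cmp C X Y Y (idt C Y) f = f) \<and>
     (\<forall>X \<in> obj C. \<forall>Y \<in> obj C. \<forall>Z \<in> obj C. \<forall>W \<in> obj C.
        \<forall>f \<in> hom C X Y. \<forall>g \<in> hom C Y Z. \<forall>h \<in> hom C Z W.
        cmp C X Y W (cmp C Y Z W h g) f = cmp C X Z W h (cmp C X Y Z g f))"

definition op_cat :: "('o, 'm, 'z) cat_scheme \<Rightarrow> ('o, 'm) cat" where
  "op_cat C = \<lparr>obj = obj C, hom = (\<lambda>X Y. hom C Y X), idt = idt C,
     cmp = (\<lambda>X Y Z g f. cmp C Z Y X f g)\<rparr>"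

definition prod_cat ::
    "('o, 'm, 'y) cat_scheme \<Rightarrow> ('p, 'n, 'z) cat_scheme \<Rightarrow> ('o \<times> 'p, 'm \<times> 'n) cat" where
  "prod_cat C D = \<lparr>obj = obj C \<times> obj D,
     hom = (\<lambda>(X, K) (Y, L). hom C X Y \<times> hom D K L),
     idt = (\<lambda>(X, K). (idt C X, idt D K)),
     cmp = (\<lambda>(X, K) (Y, L) (Z, M) (g, v) (f, u). (cmp C X Y Z g f, cmp D K L M v u))\<rparr>"

record ('o, 'm, 'p, 'n) ftor =
  fobj :: "'o \<Rightarrow> 'p"
  farr :: "'o \<Rightarrow> 'o \<Rightarrow> 'm \<Rightarrow> 'n"

definition is_arrow :: "('o, 'm, 'z) cat_scheme \<Rightarrow> 'o \<Rightarrow> 'o \<Rightarrow> 'm \<Rightarrow> bool" where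
  "is_arrow C X Y f \<longleftrightarrow> X \<in> obj C \<and> Y \<in> obj C \<and> f \<in> hom C X Y"

text \<open>
  The last two clauses make the object and arrow maps undefined outside their domains,
  so that equal functors are equal as records.
\<close>

definition is_functor ::
    "('o, 'm, 'y) cat_scheme \<Rightarrow> ('p, 'n, 'z) cat_scheme \<Rightarrow> ('o, 'm, 'p, 'n) ftor \<Rightarrow> bool" where
  "is_functor C D F \<longleftrightarrow>
     (\<forall>X \<in> obj C. fobj F X \<in> obj D) \<and>
     (\<forall>X Y f. is_arrow C X Y f \<longrightarrow> farr F X Y f \<in> hom D (fobj F X) (fobj F Y)) \<and>
     (\<forall>X \<in> obj C. farr F X X (idt C X) = idt D (fobj F X)) \<and>
     (\<forall>X Y Z f g. is_arrow C X Y f \<and> is_arrow C Y Z g \<longrightarrow>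
        farr F X Z (cmp C X Y Z g f) =
        cmp D (fobj F X) (fobj F Y) (fobj F Z) (farr F Y Z g) (farr F X Y f)) \<and>
     (\<forall>X. X \<notin> obj C \<longrightarrow> fobj F X = undefined) \<and>
     (\<forall>X Y f. \<not> is_arrow C X Y f \<longrightarrow> farr F X Y f = undefined)"

definition mk_functor ::
    "('o, 'm, 'z) cat_scheme \<Rightarrow> ('o \<Rightarrow> 'p) \<Rightarrow> ('o \<Rightarrow> 'o \<Rightarrow> 'm \<Rightarrow> 'n) \<Rightarrow> ('o, 'm, 'p, 'n) ftor" where
  "mk_functor C fo fa = \<lparr>fobj = restrict fo (obj C),
     farr = (\<lambda>X Y f. if is_arrow C X Y f then fa X Y f else undefined)\<rparr>"

text \<open>A functor from \<open>op_cat C\<close> to \<open>D\<close> regarded as a functor from \<open>C\<close> to \<open>op_cat D\<close>.\<close>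

definition op_functor :: "('o, 'm, 'p, 'n) ftor \<Rightarrow> ('o, 'm, 'p, 'n) ftor" where
  "op_functor F = \<lparr>fobj = fobj F, farr = (\<lambda>X Y. farr F Y X)\<rparr>"

text \<open>
  Partial functors \<open>F(X, -)\<close> and \<open>F(-, K)\<close> of a functor \<open>F\<close> on \<open>prod_cat C D\<close>.
\<close>

definition fix_fst ::
    "('o, 'm, 'y) cat_scheme \<Rightarrow> ('p, 'n, 'z) cat_scheme \<Rightarrow>
     ('o \<times> 'p, 'm \<times> 'n, 'q, 'l) ftor \<Rightarrow> 'o \<Rightarrow> ('p, 'n, 'q, 'l) ftor" where
  "fix_fst C D F X = mk_functor D (\<lambda>K. fobj F (X, K))
     (\<lambda>K L u. farr F (X, K) (X, L) (idt C X, u))"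

definition fix_snd ::
    "('o, 'm, 'y) cat_scheme \<Rightarrow> ('p, 'n, 'z) cat_scheme \<Rightarrow>
     ('o \<times> 'p, 'm \<times> 'n, 'q, 'l) ftor \<Rightarrow> 'p \<Rightarrow> ('o, 'm, 'q, 'l) ftor" where
  "fix_snd C D F K = mk_functor C (\<lambda>X. fobj F (X, K))
     (\<lambda>X Y f. farr F (X, K) (Y, K) (f, idt D K))"

definition left_adjoint ::
    "('o, 'm, 'y) cat_scheme \<Rightarrow> ('p, 'n, 'z) cat_scheme \<Rightarrow>
     ('o, 'm, 'p, 'n) ftor \<Rightarrow> ('p, 'n, 'o, 'm) ftor \<Rightarrow> bool" where
  "left_adjoint C D F G \<longleftrightarrow>
     is_functor C D F \<and> is_functor D C G \<and>
     (\<exists>\<Phi>. (\<forall>X \<in> obj C. \<forall>Y \<in> obj D.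
              bij_betw (\<Phi> X Y) (hom D (fobj F X) Y) (hom C X (fobj G Y))) \<and>
          (\<forall>X' X f Y Y' g. is_arrow C X' X f \<and> is_arrow D Y Y' g \<longrightarrow>
             (\<forall>h \<in> hom D (fobj F X) Y.
                \<Phi> X' Y' (cmp D (fobj F X') Y Y' g
                          (cmp D (fobj F X') (fobj F X) Y h (farr F X' X f))) =
                cmp C X' (fobj G Y) (fobj G Y') (farr G Y Y' g)
                  (cmp C X' X (fobj G Y) (\<Phi> X Y h) f))))"


section \<open>Simplicial sets\<close>

text \<open>
  The category \<open>\<Delta>\<close>: the object \<open>[n]\<close> is represented by \<open>n\<close>, and its
  underlying set is \<open>{..n}\<close>.
\<close>

definition simplex_cat :: "(nat, nat \<Rightarrow> nat) cat" where
  "simplex_cat = \<lparr>obj = UNIV,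
     hom = (\<lambda>m n. {\<theta> \<in> {..m} \<rightarrow>\<^sub>E {..n}. mono_on {..m} \<theta>}),
     idt = (\<lambda>n. \<lambda>i \<in> {..n}. i),
     cmp = (\<lambda>l m n \<eta> \<theta>. compose {..l} \<eta> \<theta>)\<rparr>"

definition sigma0 :: "nat \<Rightarrow> nat \<Rightarrow> nat" where
  "sigma0 n = (\<lambda>i \<in> {..n}. 0)"

text \<open>
  Sets are represented by subsets of a type \<open>'a\<close>. The parameter \<open>U\<close> is the collection of
  those subsets that are admitted as (small) sets. Admitting all subsets would not be
  harmless: if all hom-objects and all \<open>K\<close> range over simplicial sets with simplices in the
  same type \<open>'a\<close> without a size restriction, then the existence of all \<open>K\<close>-cylinders forces, by
  a cardinality argument (take \<open>K\<close> discrete on all of \<open>'a\<close>), every hom-set to have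
  at most one element.
\<close>

definition set_cat :: "'a set set \<Rightarrow> ('a set, 'a \<Rightarrow> 'a) cat" where
  "set_cat U = \<lparr>obj = U, hom = (\<lambda>A B. A \<rightarrow>\<^sub>E B), idt = (\<lambda>A. \<lambda>x \<in> A. x),
     cmp = (\<lambda>A B C g f. compose A g f)\<rparr>"

text \<open>
  A simplicial set \<open>A\<close> is a functor from the opposite of \<open>\<Delta>\<close> to sets: \<open>fobj A n\<close> is the
  set of \<open>n\<close>-simplices, and \<open>farr A n m \<theta>\<close> is \<open>\<theta>\<^sup>*\<close> from
  \<open>n\<close>-simplices to \<open>m\<close>-simplices, for \<open>\<theta>\<close> from \<open>[m]\<close> to \<open>[n]\<close>.
\<close>

type_synonym 'a sset = "(nat, nat \<Rightarrow> nat, 'a set, 'a \<Rightarrow> 'a) ftor"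
type_synonym ('a, 'b) smap = "nat \<Rightarrow> 'a \<Rightarrow> 'b"

definition is_sset :: "'a set set \<Rightarrow> 'a sset \<Rightarrow> bool" where
  "is_sset U A \<longleftrightarrow> is_functor (op_cat simplex_cat) (set_cat U) A"

definition sset_hom :: "'a sset \<Rightarrow> 'b sset \<Rightarrow> ('a, 'b) smap set" where
  "sset_hom A B = {f. (\<forall>n. f n \<in> fobj A n \<rightarrow>\<^sub>E fobj B n) \<and>
     (\<forall>m n. \<forall>\<theta> \<in> hom simplex_cat m n. \<forall>x \<in> fobj A n.
        f m (farr A n m \<theta> x) = farr B n m \<theta> (f n x))}"

definition sset_id :: "'a sset \<Rightarrow> ('a, 'a) smap" where
  "sset_id A = (\<lambda>n. \<lambda>x \<in> fobj A n. x)"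

definition sset_comp :: "'a sset \<Rightarrow> ('b, 'c) smap \<Rightarrow> ('a, 'b) smap \<Rightarrow> ('a, 'c) smap" where
  "sset_comp A g f = (\<lambda>n. compose (fobj A n) (g n) (f n))"

definition sset_cat :: "'a set set \<Rightarrow> ('a sset, ('a, 'a) smap) cat" where
  "sset_cat U = \<lparr>obj = {A. is_sset U A}, hom = sset_hom, idt = sset_id,
     cmp = (\<lambda>A B C g f. sset_comp A g f)\<rparr>"

definition sset_iso :: "'a sset \<Rightarrow> 'b sset \<Rightarrow> ('a, 'b) smap \<Rightarrow> bool" where
  "sset_iso A B f \<longleftrightarrow> f \<in> sset_hom A B \<and>
     (\<exists>g \<in> sset_hom B A. sset_comp A g f = sset_id A \<and> sset_comp B f g = sset_id B)"

definition sset_prod :: "'a sset \<Rightarrow> 'b sset \<Rightarrow> ('a \<times> 'b) sset" where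
  "sset_prod A B = \<lparr>fobj = (\<lambda>n. fobj A n \<times> fobj B n),
     farr = (\<lambda>n m. \<lambda>\<theta> \<in> hom simplex_cat m n. \<lambda>x \<in> fobj A n \<times> fobj B n.
               (farr A n m \<theta> (fst x), farr B n m \<theta> (snd x)))\<rparr>"

definition sset_pr1 :: "'a sset \<Rightarrow> 'b sset \<Rightarrow> ('a \<times> 'b, 'a) smap" where
  "sset_pr1 A B = (\<lambda>n. \<lambda>x \<in> fobj A n \<times> fobj B n. fst x)"

definition sset_pr2 :: "'a sset \<Rightarrow> 'b sset \<Rightarrow> ('a \<times> 'b, 'b) smap" where
  "sset_pr2 A B = (\<lambda>n. \<lambda>x \<in> fobj A n \<times> fobj B n. snd x)"

text \<open>The map \<open>(f, g)\<close> from \<open>A\<close> to a product.\<close>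

definition sset_pair ::
    "'a sset \<Rightarrow> ('a, 'b) smap \<Rightarrow> ('a, 'c) smap \<Rightarrow> ('a, 'b \<times> 'c) smap" where
  "sset_pair A f g = (\<lambda>n. \<lambda>x \<in> fobj A n. (f n x, g n x))"

text \<open>The map \<open>f \<times> g\<close> on \<open>A \<times> B\<close>.\<close>

definition sset_map_prod ::
    "'a sset \<Rightarrow> 'b sset \<Rightarrow> ('a, 'c) smap \<Rightarrow> ('b, 'd) smap \<Rightarrow> ('a \<times> 'b, 'c \<times> 'd) smap" where
  "sset_map_prod A B f g = (\<lambda>n. \<lambda>x \<in> fobj A n \<times> fobj B n. (f n (fst x), g n (snd x)))"

definition std_simplex :: "nat \<Rightarrow> (nat \<Rightarrow> nat) sset" where
  "std_simplex n = \<lparr>fobj = (\<lambda>m. hom simplex_cat m n),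
     farr = (\<lambda>m l. \<lambda>\<theta> \<in> hom simplex_cat l m. \<lambda>\<eta> \<in> hom simplex_cat m n.
               cmp simplex_cat l m n \<eta> \<theta>)\<rparr>"

definition std_simplex_map ::
    "nat \<Rightarrow> nat \<Rightarrow> (nat \<Rightarrow> nat) \<Rightarrow> (nat \<Rightarrow> nat, nat \<Rightarrow> nat) smap" where
  "std_simplex_map m n \<theta> = (\<lambda>l. \<lambda>\<eta> \<in> hom simplex_cat l m. cmp simplex_cat l m n \<theta> \<eta>)"


section \<open>Internal hom and evaluation\<close>

type_synonym ('a, 'b) simplex_of_hom = "('a \<times> (nat \<Rightarrow> nat), 'b) smap"

definition sset_ihom :: "'a sset \<Rightarrow> 'b sset \<Rightarrow> ('a, 'b) simplex_of_hom sset" where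
  "sset_ihom A B = \<lparr>fobj = (\<lambda>n. sset_hom (sset_prod A (std_simplex n)) B),
     farr = (\<lambda>n m. \<lambda>\<theta> \<in> hom simplex_cat m n.
               \<lambda>f \<in> sset_hom (sset_prod A (std_simplex n)) B.
                 sset_comp (sset_prod A (std_simplex m)) f
                   (sset_map_prod A (std_simplex m) (sset_id A) (std_simplex_map m n \<theta>)))\<rparr>"

text \<open>For \<open>u\<close> from \<open>C\<close> to \<open>A\<close>, the map from \<open>sset_ihom A B\<close> to \<open>sset_ihom C B\<close>.\<close>

definition sset_ihom_pre ::
    "'c sset \<Rightarrow> 'a sset \<Rightarrow> 'b sset \<Rightarrow> ('c, 'a) smap \<Rightarrow>
     (('a, 'b) simplex_of_hom, ('c, 'b) simplex_of_hom) smap" where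
  "sset_ihom_pre C A B u = (\<lambda>n. \<lambda>f \<in> fobj (sset_ihom A B) n.
     sset_comp (sset_prod C (std_simplex n)) f
       (sset_map_prod C (std_simplex n) u (sset_id (std_simplex n))))"

text \<open>For \<open>u\<close> from \<open>B\<close> to \<open>C\<close>, the map from \<open>sset_ihom A B\<close> to \<open>sset_ihom A C\<close>.\<close>

definition sset_ihom_post ::
    "'a sset \<Rightarrow> 'b sset \<Rightarrow> ('b, 'c) smap \<Rightarrow>
     (('a, 'b) simplex_of_hom, ('a, 'c) simplex_of_hom) smap" where
  "sset_ihom_post A B u = (\<lambda>n. \<lambda>f \<in> fobj (sset_ihom A B) n.
     sset_comp (sset_prod A (std_simplex n)) u f)"

definition sset_ev :: "'a sset \<Rightarrow> 'b sset \<Rightarrow> ('a \<times> ('a, 'b) simplex_of_hom, 'b) smap" where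
  "sset_ev A B = (\<lambda>n. \<lambda>x \<in> fobj A n \<times> fobj (sset_ihom A B) n.
     snd x n (fst x, idt simplex_cat n))"


section \<open>Simplicial categories\<close>

text \<open>
  \<open>enr\<close> is the functor \<open>\<underline>S(-,-)\<close>, \<open>scmp S X Y Z\<close> is the composition map
  on \<open>\<underline>S(X,Y) \<times> \<underline>S(Y,Z)\<close> (so the pair \<open>(f, g)\<close> is sent to
  \<open>g\<close> after \<open>f\<close>), and \<open>tld S X Y\<close> is the bijection from morphisms to vertices.
\<close>

record ('o, 'm, 'a) simp_cat = "('o, 'm) cat" +
  enr :: "('o \<times> 'o, 'm \<times> 'm, 'a sset, ('a, 'a) smap) ftor"
  scmp :: "'o \<Rightarrow> 'o \<Rightarrow> 'o \<Rightarrow> ('a \<times> 'a, 'a) smap"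
  tld :: "'o \<Rightarrow> 'o \<Rightarrow> 'm \<Rightarrow> 'a"

definition Map :: "('o, 'm, 'a) simp_cat \<Rightarrow> 'o \<Rightarrow> 'o \<Rightarrow> 'a sset" where
  "Map S X Y = fobj (enr S) (X, Y)"

text \<open>\<open>Map_post S X Y Z g\<close> is \<open>\<underline>S(X,g)\<close> for \<open>g\<close> from \<open>Y\<close> to \<open>Z\<close>;
  \<open>Map_pre S X Y Z f\<close> is \<open>\<underline>S(f,Z)\<close> for \<open>f\<close> from \<open>X\<close> to \<open>Y\<close>.\<close>

definition Map_post :: "('o, 'm, 'a) simp_cat \<Rightarrow> 'o \<Rightarrow> 'o \<Rightarrow> 'o \<Rightarrow> 'm \<Rightarrow> ('a, 'a) smap" where
  "Map_post S X Y Z g = farr (enr S) (X, Y) (X, Z) (idt S X, g)"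

definition Map_pre :: "('o, 'm, 'a) simp_cat \<Rightarrow> 'o \<Rightarrow> 'o \<Rightarrow> 'o \<Rightarrow> 'm \<Rightarrow> ('a, 'a) smap" where
  "Map_pre S X Y Z f = farr (enr S) (Y, Z) (X, Z) (f, idt S Z)"

text \<open>\<open>(\<sigma>\<^sup>n\<^sub>0)\<^sup>*\<close> applied to the vertex of a morphism \<open>f\<close>.\<close>

definition degen :: "('o, 'm, 'a) simp_cat \<Rightarrow> 'o \<Rightarrow> 'o \<Rightarrow> nat \<Rightarrow> 'm \<Rightarrow> 'a" where
  "degen S X Y n f = farr (Map S X Y) 0 n (sigma0 n) (tld S X Y f)"

definition is_simplicial_category :: "'a set set \<Rightarrow> ('o, 'm, 'a) simp_cat \<Rightarrow> bool" where
  "is_simplicial_category U S \<longleftrightarrow>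
     is_category S \<and>
     \<comment> \<open>(S1)\<close>
     is_functor (prod_cat (op_cat S) S) (sset_cat U) (enr S) \<and>
     \<comment> \<open>(S2)\<close>
     (\<forall>X \<in> obj S. \<forall>Y \<in> obj S. \<forall>Z \<in> obj S.
        scmp S X Y Z \<in> sset_hom (sset_prod (Map S X Y) (Map S Y Z)) (Map S X Z)) \<and>
     \<comment> \<open>(S3)\<close>
     (\<forall>X \<in> obj S. \<forall>Y \<in> obj S. bij_betw (tld S X Y) (hom S X Y) (fobj (Map S X Y) 0)) \<and>
     (\<forall>X' X f Y Y' g. is_arrow S X' X f \<and> is_arrow S Y Y' g \<longrightarrow>
        (\<forall>h \<in> hom S X Y.
           tld S X' Y' (cmp S X' Y Y' g (cmp S X' X Y h f)) =
           farr (enr S) (X, Y) (X', Y') (f, g) 0 (tld S X Y h))) \<and>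
     \<comment> \<open>(S4)\<close>
     (\<forall>X \<in> obj S. \<forall>Y \<in> obj S. \<forall>Z \<in> obj S. \<forall>W \<in> obj S. \<forall>n.
        \<forall>f \<in> fobj (Map S X Y) n. \<forall>g \<in> fobj (Map S Y Z) n. \<forall>h \<in> fobj (Map S Z W) n.
          scmp S X Y W n (f, scmp S Y Z W n (g, h)) =
          scmp S X Z W n (scmp S X Y Z n (f, g), h)) \<and>
     \<comment> \<open>(S5)\<close>
     (\<forall>X \<in> obj S. \<forall>Y \<in> obj S. \<forall>Z \<in> obj S. \<forall>n.
        \<forall>f \<in> fobj (Map S X Y) n. \<forall>g \<in> hom S Y Z.
          Map_post S X Y Z g n f = scmp S X Y Z n (f, degen S Y Z n g)) \<and>
     (\<forall>X \<in> obj S. \<forall>Y \<in> obj S. \<forall>Z \<in> obj S. \<forall>n.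
        \<forall>f \<in> hom S X Y. \<forall>g \<in> fobj (Map S Y Z) n.
          Map_pre S X Y Z f n g = scmp S X Y Z n (degen S X Y n f, g))"


section \<open>Cylinders and paths\<close>

record ('o, 'a) cylinder =
  cyl_obj :: 'o
  cyl_map :: "('a, 'a) smap"
  cyl_iso :: "'o \<Rightarrow> ('a, ('a, 'a) simplex_of_hom) smap"

definition is_cylinder ::
    "('o, 'm, 'a) simp_cat \<Rightarrow> 'o \<Rightarrow> 'a sset \<Rightarrow> ('o, 'a) cylinder \<Rightarrow> bool" where
  "is_cylinder S X K c \<longleftrightarrow>
     (let XK = cyl_obj c; \<alpha> = cyl_map c in
       XK \<in> obj S \<and> \<alpha> \<in> sset_hom K (Map S X XK) \<and>
       (\<forall>Y \<in> obj S. let \<phi> = cyl_iso c Y; P = sset_prod K (Map S XK Y) in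
          sset_iso (Map S XK Y) (sset_ihom K (Map S X Y)) \<phi> \<and>
          sset_comp P (sset_ev K (Map S X Y))
            (sset_map_prod K (Map S XK Y) (sset_id K) \<phi>) =
          sset_comp P (scmp S X XK Y)
            (sset_map_prod K (Map S XK Y) \<alpha> (sset_id (Map S XK Y)))))"

record ('o, 'a) pathobj =
  path_obj :: 'o
  path_map :: "('a, 'a) smap"
  path_iso :: "'o \<Rightarrow> ('a, ('a, 'a) simplex_of_hom) smap"

definition is_path ::
    "('o, 'm, 'a) simp_cat \<Rightarrow> 'o \<Rightarrow> 'a sset \<Rightarrow> ('o, 'a) pathobj \<Rightarrow> bool" where
  "is_path S X K p \<longleftrightarrow>
     (let XK = path_obj p; \<beta> = path_map p in
       XK \<in> obj S \<and> \<beta> \<in> sset_hom K (Map S XK X) \<and>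
       (\<forall>Y \<in> obj S. let \<psi> = path_iso p Y; P = sset_prod K (Map S Y XK) in
          sset_iso (Map S Y XK) (sset_ihom K (Map S Y X)) \<psi> \<and>
          sset_comp P (sset_ev K (Map S Y X))
            (sset_map_prod K (Map S Y XK) (sset_id K) \<psi>) =
          sset_comp P (scmp S Y XK X)
            (sset_pair P (sset_pr2 K (Map S Y XK))
              (sset_comp P \<beta> (sset_pr1 K (Map S Y XK))))))"

definition cylinder_choice ::
    "'a set set \<Rightarrow> ('o, 'm, 'a) simp_cat \<Rightarrow> ('o \<Rightarrow> 'a sset \<Rightarrow> ('o, 'a) cylinder) \<Rightarrow> bool" where
  "cylinder_choice U S c \<longleftrightarrow>
     (\<forall>X \<in> obj S. \<forall>K \<in> obj (sset_cat U). is_cylinder S X K (c X K))"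

definition path_choice ::
    "'a set set \<Rightarrow> ('o, 'm, 'a) simp_cat \<Rightarrow> ('o \<Rightarrow> 'a sset \<Rightarrow> ('o, 'a) pathobj) \<Rightarrow> bool" where
  "path_choice U S p \<longleftrightarrow>
     (\<forall>X \<in> obj S. \<forall>K \<in> obj (sset_cat U). is_path S X K (p X K))"


section \<open>The functors determined by a choice of cylinders or paths\<close>

type_synonym ('o, 'm, 'a) sset_action =
  "('o \<times> 'a sset, 'm \<times> ('a, 'a) smap, 'o, 'm) ftor"

definition is_tensor_functor ::
    "'a set set \<Rightarrow> ('o, 'm, 'a) simp_cat \<Rightarrow> ('o \<Rightarrow> 'a sset \<Rightarrow> ('o, 'a) cylinder) \<Rightarrow>
     ('o, 'm, 'a) sset_action \<Rightarrow> bool" where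
  "is_tensor_functor U S c T \<longleftrightarrow>
     is_functor (prod_cat S (sset_cat U)) S T \<and>
     (\<forall>X \<in> obj S. \<forall>K \<in> obj (sset_cat U). fobj T (X, K) = cyl_obj (c X K)) \<and>
     (\<forall>X \<in> obj S. \<forall>K L u. is_arrow (sset_cat U) K L u \<longrightarrow>
        sset_comp K
          (Map_post S X (cyl_obj (c X K)) (cyl_obj (c X L)) (farr T (X, K) (X, L) (idt S X, u)))
          (cyl_map (c X K)) =
        sset_comp K (cyl_map (c X L)) u) \<and>
     (\<forall>K \<in> obj (sset_cat U). \<forall>X Y f. is_arrow S X Y f \<longrightarrow>
        sset_comp K
          (Map_post S X (cyl_obj (c X K)) (cyl_obj (c Y K)) (farr T (X, K) (Y, K) (f, sset_id K)))
          (cyl_map (c X K)) =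
        sset_comp K (Map_pre S X Y (cyl_obj (c Y K)) f) (cyl_map (c Y K)))"

definition tensor ::
    "'a set set \<Rightarrow> ('o, 'm, 'a) simp_cat \<Rightarrow> ('o \<Rightarrow> 'a sset \<Rightarrow> ('o, 'a) cylinder) \<Rightarrow>
     ('o, 'm, 'a) sset_action" where
  "tensor U S c = (THE T. is_tensor_functor U S c T)"

definition is_cotensor_functor ::
    "'a set set \<Rightarrow> ('o, 'm, 'a) simp_cat \<Rightarrow> ('o \<Rightarrow> 'a sset \<Rightarrow> ('o, 'a) pathobj) \<Rightarrow>
     ('o, 'm, 'a) sset_action \<Rightarrow> bool" where
  "is_cotensor_functor U S p T \<longleftrightarrow>
     is_functor (prod_cat S (op_cat (sset_cat U))) S T \<and>
     (\<forall>X \<in> obj S. \<forall>K \<in> obj (sset_cat U). fobj T (X, K) = path_obj (p X K)) \<and>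
     (\<forall>X \<in> obj S. \<forall>K L u. is_arrow (sset_cat U) K L u \<longrightarrow>
        sset_comp K
          (Map_pre S (path_obj (p X L)) (path_obj (p X K)) X (farr T (X, L) (X, K) (idt S X, u)))
          (path_map (p X K)) =
        sset_comp K (path_map (p X L)) u) \<and>
     (\<forall>K \<in> obj (sset_cat U). \<forall>Y X f. is_arrow S Y X f \<longrightarrow>
        sset_comp K
          (Map_pre S (path_obj (p Y K)) (path_obj (p X K)) X (farr T (Y, K) (X, K) (f, sset_id K)))
          (path_map (p X K)) =
        sset_comp K (Map_post S (path_obj (p Y K)) Y X f) (path_map (p Y K)))"

definition cotensor ::
    "'a set set \<Rightarrow> ('o, 'm, 'a) simp_cat \<Rightarrow> ('o \<Rightarrow> 'a sset \<Rightarrow> ('o, 'a) pathobj) \<Rightarrow>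
     ('o, 'm, 'a) sset_action" where
  "cotensor U S p = (THE T. is_cotensor_functor U S p T)"

text \<open>
  Naturality of \<open>\<phi>\<close> and \<open>\<psi>\<close> in each variable. The internal hom has its simplices in a type
  other than \<open>'a\<close>, so naturality is spelled out as commuting squares of simplicial maps.
\<close>

definition cyl_iso_natural ::
    "'a set set \<Rightarrow> ('o, 'm, 'a) simp_cat \<Rightarrow> ('o \<Rightarrow> 'a sset \<Rightarrow> ('o, 'a) cylinder) \<Rightarrow> bool" where
  "cyl_iso_natural U S c \<longleftrightarrow>
     (let T = tensor U S c; ob = (\<lambda>X K. cyl_obj (c X K)); \<phi> = (\<lambda>K X Y. cyl_iso (c X K) Y) in
       \<comment> \<open>in \<open>K\<close>\<close>
       (\<forall>X \<in> obj S. \<forall>Y \<in> obj S. \<forall>K L u. is_arrow (sset_cat U) K L u \<longrightarrow>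
          sset_comp (Map S (ob X L) Y) (\<phi> K X Y)
            (Map_pre S (ob X K) (ob X L) Y (farr T (X, K) (X, L) (idt S X, u))) =
          sset_comp (Map S (ob X L) Y) (sset_ihom_pre K L (Map S X Y) u) (\<phi> L X Y)) \<and>
       \<comment> \<open>in \<open>X\<close>\<close>
       (\<forall>K \<in> obj (sset_cat U). \<forall>Y \<in> obj S. \<forall>X X' f. is_arrow S X X' f \<longrightarrow>
          sset_comp (Map S (ob X' K) Y) (\<phi> K X Y)
            (Map_pre S (ob X K) (ob X' K) Y (farr T (X, K) (X', K) (f, sset_id K))) =
          sset_comp (Map S (ob X' K) Y)
            (sset_ihom_post K (Map S X' Y) (Map_pre S X X' Y f)) (\<phi> K X' Y)) \<and>
       \<comment> \<open>in \<open>Y\<close>\<close>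
       (\<forall>K \<in> obj (sset_cat U). \<forall>X \<in> obj S. \<forall>Y Y' g. is_arrow S Y Y' g \<longrightarrow>
          sset_comp (Map S (ob X K) Y) (\<phi> K X Y') (Map_post S (ob X K) Y Y' g) =
          sset_comp (Map S (ob X K) Y)
            (sset_ihom_post K (Map S X Y) (Map_post S X Y Y' g)) (\<phi> K X Y)))"

definition path_iso_natural ::
    "'a set set \<Rightarrow> ('o, 'm, 'a) simp_cat \<Rightarrow> ('o \<Rightarrow> 'a sset \<Rightarrow> ('o, 'a) pathobj) \<Rightarrow> bool" where
  "path_iso_natural U S p \<longleftrightarrow>
     (let T = cotensor U S p; ob = (\<lambda>X K. path_obj (p X K)); \<psi> = (\<lambda>K Y X. path_iso (p X K) Y) in
       \<comment> \<open>in \<open>K\<close>\<close>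
       (\<forall>X \<in> obj S. \<forall>Y \<in> obj S. \<forall>K L u. is_arrow (sset_cat U) K L u \<longrightarrow>
          sset_comp (Map S Y (ob X L)) (\<psi> K Y X)
            (Map_post S Y (ob X L) (ob X K) (farr T (X, L) (X, K) (idt S X, u))) =
          sset_comp (Map S Y (ob X L)) (sset_ihom_pre K L (Map S Y X) u) (\<psi> L Y X)) \<and>
       \<comment> \<open>in \<open>X\<close>\<close>
       (\<forall>K \<in> obj (sset_cat U). \<forall>Y \<in> obj S. \<forall>X X' f. is_arrow S X X' f \<longrightarrow>
          sset_comp (Map S Y (ob X K)) (\<psi> K Y X')
            (Map_post S Y (ob X K) (ob X' K) (farr T (X, K) (X', K) (f, sset_id K))) =
          sset_comp (Map S Y (ob X K))
            (sset_ihom_post K (Map S Y X) (Map_post S Y X X' f)) (\<psi> K Y X)) \<and>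
       \<comment> \<open>in \<open>Y\<close>\<close>
       (\<forall>K \<in> obj (sset_cat U). \<forall>X \<in> obj S. \<forall>Y Y' g. is_arrow S Y Y' g \<longrightarrow>
          sset_comp (Map S Y' (ob X K)) (\<psi> K Y X) (Map_pre S Y Y' (ob X K) g) =
          sset_comp (Map S Y' (ob X K))
            (sset_ihom_post K (Map S Y' X) (Map_pre S Y Y' X g)) (\<psi> K Y' X)))"

end

theory Submission
  imports Defs
begin

text \<open>
  By Yoneda, the evaluation equation of a cylinder says
  \<open>\<phi>(h)(k, \<theta>) = \<theta>\<^sup>*h \<bullet> \<alpha>(k)\<close>. At vertices this shows that a morphism
  \<open>g\<close> out of \<open>X \<otimes> K\<close> amounts to the simplicial map \<open>\<S>(X,g) \<circ> \<alpha>\<close>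
  on \<open>K\<close>, so that \<open>f \<otimes> u\<close> is the unique morphism with
  \<open>\<S>(X, f \<otimes> u) \<circ> \<alpha> = \<S>(f, Y \<otimes> L) \<circ> \<alpha> \<circ> u\<close>. Naturality of \<open>\<phi>\<close>
  and the first adjunction follow from associativity of \<open>\<bullet>\<close>. A path of \<open>X\<close> is a cylinder of
  \<open>X\<close> in the opposite simplicial category, which gives everything about \<open>\<psi>\<close> by duality;
  the third adjunction composes the two bijections.
\<close>


section \<open>Categories and functors\<close>

text \<open>A tensor functor is specified by one equation in K and one in X, whereas functoriality
  and uniqueness concern arrows (f, u) of the product category. The relation \<open>induced\<close>
  merges both equations into one for pairs; it is stable under composition and has exactly one
  solution, which settles existence and uniqueness of the functor together. Only after that does the
  definite description in \<open>tensor\<close> carry information. The values of \<phi> lie in an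
  internal hom over another type, so its naturality is not a statement inside
  \<open>sset_cat U\<close>: both sides are compared at every pair (k, \<theta>). There (S5) writes
  S(X,g) and S(f,Z) as \<bullet> with a degenerate vertex, and what remains is rebracketing by (S4)
  and the equation for \<open>induced\<close>. Duality keeps the mapping spaces and swaps the
  factors of \<bullet>, so \<open>Map_post\<close> and \<open>Map_pre\<close> change places.\<close>

lemma category_cmp:
  "is_category C \<Longrightarrow> is_arrow C X Y f \<Longrightarrow> is_arrow C Y Z g \<Longrightarrow> cmp C X Y Z g f \<in> hom C X Z"
  by (simp add: is_category_def is_arrow_def)

lemma arrow_idt: "is_category C \<Longrightarrow> X \<in> obj C \<Longrightarrow> is_arrow C X X (idt C X)"
  by (simp add: is_category_def is_arrow_def)

lemma arrow_cmp:
  "is_category C \<Longrightarrow> is_arrow C X Y f \<Longrightarrow> is_arrow C Y Z g \<Longrightarrow> is_arrow C X Z (cmp C X Y Z g f)"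
  by (simp add: is_category_def is_arrow_def)

lemma category_idt_right:
  "is_category C \<Longrightarrow> is_arrow C X Y f \<Longrightarrow> cmp C X X Y f (idt C X) = f"
  by (simp add: is_category_def is_arrow_def)

lemma category_idt_left:
  "is_category C \<Longrightarrow> is_arrow C X Y f \<Longrightarrow> cmp C X Y Y (idt C Y) f = f"
  by (simp add: is_category_def is_arrow_def)

lemma category_assoc:
  "is_category C \<Longrightarrow> is_arrow C X Y f \<Longrightarrow> is_arrow C Y Z g \<Longrightarrow> is_arrow C Z W h \<Longrightarrow>
   cmp C X Y W (cmp C Y Z W h g) f = cmp C X Z W h (cmp C X Y Z g f)"
  by (simp add: is_category_def is_arrow_def)

lemma op_cat_simps [simp]:
  "obj (op_cat C) = obj C" "hom (op_cat C) X Y = hom C Y X" "idt (op_cat C) = idt C"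
  "cmp (op_cat C) X Y Z g f = cmp C Z Y X f g"
  by (simp_all add: op_cat_def)

lemma prod_cat_simps [simp]:
  "obj (prod_cat C D) = obj C \<times> obj D"
  "hom (prod_cat C D) (X, K) (Y, L) = hom C X Y \<times> hom D K L"
  "idt (prod_cat C D) (X, K) = (idt C X, idt D K)"
  "cmp (prod_cat C D) (X, K) (Y, L) (Z, M) (g, v) (f, u) = (cmp C X Y Z g f, cmp D K L M v u)"
  by (simp_all add: prod_cat_def)

lemma is_arrow_op [simp]: "is_arrow (op_cat C) X Y f \<longleftrightarrow> is_arrow C Y X f"
  by (auto simp: is_arrow_def)

lemma is_arrow_prod [simp]:
  "is_arrow (prod_cat C D) (X, K) (Y, L) (f, u) \<longleftrightarrow> is_arrow C X Y f \<and> is_arrow D K L u"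
  by (auto simp: is_arrow_def)

lemma category_op: "is_category C \<Longrightarrow> is_category (op_cat C)"
  unfolding is_category_def by simp

lemma category_prod: "is_category C \<Longrightarrow> is_category D \<Longrightarrow> is_category (prod_cat C D)"
  unfolding is_category_def by auto

lemma functor_obj: "is_functor C D F \<Longrightarrow> X \<in> obj C \<Longrightarrow> fobj F X \<in> obj D"
  by (simp add: is_functor_def)

lemma functor_hom:
  "is_functor C D F \<Longrightarrow> is_arrow C X Y f \<Longrightarrow> farr F X Y f \<in> hom D (fobj F X) (fobj F Y)"
  by (simp add: is_functor_def)

lemma functor_arrow:
  "is_functor C D F \<Longrightarrow> is_arrow C X Y f \<Longrightarrow> is_arrow D (fobj F X) (fobj F Y) (farr F X Y f)"
  by (simp add: is_functor_def is_arrow_def)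

lemma functor_idt:
  "is_functor C D F \<Longrightarrow> X \<in> obj C \<Longrightarrow> farr F X X (idt C X) = idt D (fobj F X)"
  by (simp add: is_functor_def)

lemma functor_cmp:
  "is_functor C D F \<Longrightarrow> is_arrow C X Y f \<Longrightarrow> is_arrow C Y Z g \<Longrightarrow>
   farr F X Z (cmp C X Y Z g f) =
   cmp D (fobj F X) (fobj F Y) (fobj F Z) (farr F Y Z g) (farr F X Y f)"
  by (auto simp: is_functor_def)

lemma op_functor_simps [simp]:
  "fobj (op_functor F) = fobj F" "farr (op_functor F) X Y = farr F Y X"
  by (simp_all add: op_functor_def)

lemma op_functor_op_functor [simp]: "op_functor (op_functor F) = F"
  by (simp add: op_functor_def)

lemma is_functor_op_functor: "is_functor (op_cat C) (op_cat D) (op_functor F) \<longleftrightarrow> is_functor C D F"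
  unfolding is_functor_def by (simp; blast)

text \<open>The \<open>undefined\<close> clauses of \<open>is_functor\<close> settle the values off
  the domain, so agreement on objects and arrows already gives equality of records. The uniqueness
  behind \<open>THE\<close> in \<open>tensor\<close> rests on this.\<close>

lemma functor_eqI:
  assumes "is_functor C D F" "is_functor C D G"
    and "\<And>X. X \<in> obj C \<Longrightarrow> fobj F X = fobj G X"
    and "\<And>X Y f. is_arrow C X Y f \<Longrightarrow> farr F X Y f = farr G X Y f"
  shows "F = G"
proof -
  have "fobj F X = fobj G X" for X
    using assms by (cases "X \<in> obj C") (auto simp: is_functor_def)
  moreover have "farr F X Y f = farr G X Y f" for X Y f
    using assms by (cases "is_arrow C X Y f") (auto simp: is_functor_def)
  ultimately show ?thesis by (intro ftor.equality) (auto simp: fun_eq_iff)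
qed

lemma fobj_mk_functor [simp]: "X \<in> obj C \<Longrightarrow> fobj (mk_functor C fo fa) X = fo X"
  by (simp add: mk_functor_def)

lemma farr_mk_functor [simp]: "is_arrow C X Y f \<Longrightarrow> farr (mk_functor C fo fa) X Y f = fa X Y f"
  by (simp add: mk_functor_def)

lemma is_functor_mk_functor:
  assumes C: "is_category C"
    and "\<And>X. X \<in> obj C \<Longrightarrow> fo X \<in> obj D"
    and "\<And>X Y f. is_arrow C X Y f \<Longrightarrow> fa X Y f \<in> hom D (fo X) (fo Y)"
    and "\<And>X. X \<in> obj C \<Longrightarrow> fa X X (idt C X) = idt D (fo X)"
    and "\<And>X Y Z f g. is_arrow C X Y f \<Longrightarrow> is_arrow C Y Z g \<Longrightarrow>
      fa X Z (cmp C X Y Z g f) = cmp D (fo X) (fo Y) (fo Z) (fa Y Z g) (fa X Y f)"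
  shows "is_functor C D (mk_functor C fo fa)"
proof -
  have ob: "X \<in> obj C" "Y \<in> obj C" if "is_arrow C X Y f" for X Y f
    using that by (auto simp: is_arrow_def)
  show ?thesis
    unfolding is_functor_def
  proof (intro conjI allI impI ballI)
    fix X Y Z f g assume fg: "is_arrow C X Y f \<and> is_arrow C Y Z g"
    then show "farr (mk_functor C fo fa) X Z (cmp C X Y Z g f) =
      cmp D (fobj (mk_functor C fo fa) X) (fobj (mk_functor C fo fa) Y)
       (fobj (mk_functor C fo fa) Z) (farr (mk_functor C fo fa) Y Z g) (farr (mk_functor C fo fa) X Y f)"
      using arrow_cmp[OF C, of X Y f Z g] ob[of X Y f] ob[of Y Z g] assms(5) by simp
  next
    fix X Y f assume "is_arrow C X Y f"
    then show "farr (mk_functor C fo fa) X Y f \<in>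
        hom D (fobj (mk_functor C fo fa) X) (fobj (mk_functor C fo fa) Y)"
      using ob assms(3) by simp
  next
    fix X assume "X \<in> obj C"
    then show "farr (mk_functor C fo fa) X X (idt C X) = idt D (fobj (mk_functor C fo fa) X)"
      using arrow_idt[OF C] assms(4) by simp
  qed (use assms(2) in \<open>auto simp: mk_functor_def\<close>)
qed

lemma is_functor_fix_fst:
  assumes F: "is_functor (prod_cat C D) E F" and C: "is_category C" and D: "is_category D"
    and X: "X \<in> obj C"
  shows "is_functor D E (fix_fst C D F X)"
  unfolding fix_fst_def
proof (rule is_functor_mk_functor[OF D])
  fix K assume "K \<in> obj D"
  then show "fobj F (X, K) \<in> obj E" "farr F (X, K) (X, K) (idt C X, idt D K) = idt E (fobj F (X, K))"
    using functor_obj[OF F] functor_idt[OF F, of "(X, K)"] X by auto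
next
  fix K L u assume "is_arrow D K L u"
  then show "farr F (X, K) (X, L) (idt C X, u) \<in> hom E (fobj F (X, K)) (fobj F (X, L))"
    using functor_hom[OF F] arrow_idt[OF C X] by auto
next
  fix K L M u v assume "is_arrow D K L u" "is_arrow D L M v"
  then show "farr F (X, K) (X, M) (idt C X, cmp D K L M v u) =
    cmp E (fobj F (X, K)) (fobj F (X, L)) (fobj F (X, M))
      (farr F (X, L) (X, M) (idt C X, v)) (farr F (X, K) (X, L) (idt C X, u))"
    using functor_cmp[OF F, of "(X, K)" "(X, L)" "(idt C X, u)" "(X, M)" "(idt C X, v)"]
      arrow_idt[OF C X] category_idt_left[OF C arrow_idt[OF C X]] by simp
qed

lemma is_functor_fix_snd:
  assumes F: "is_functor (prod_cat C D) E F" and C: "is_category C" and D: "is_category D"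
    and K: "K \<in> obj D"
  shows "is_functor C E (fix_snd C D F K)"
  unfolding fix_snd_def
proof (rule is_functor_mk_functor[OF C])
  fix X assume "X \<in> obj C"
  then show "fobj F (X, K) \<in> obj E" "farr F (X, K) (X, K) (idt C X, idt D K) = idt E (fobj F (X, K))"
    using functor_obj[OF F] functor_idt[OF F, of "(X, K)"] K by auto
next
  fix X Y f assume "is_arrow C X Y f"
  then show "farr F (X, K) (Y, K) (f, idt D K) \<in> hom E (fobj F (X, K)) (fobj F (Y, K))"
    using functor_hom[OF F] arrow_idt[OF D K] by auto
next
  fix X Y Z f g assume "is_arrow C X Y f" "is_arrow C Y Z g"
  then show "farr F (X, K) (Z, K) (cmp C X Y Z g f, idt D K) =
    cmp E (fobj F (X, K)) (fobj F (Y, K)) (fobj F (Z, K))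
      (farr F (Y, K) (Z, K) (g, idt D K)) (farr F (X, K) (Y, K) (f, idt D K))"
    using functor_cmp[OF F, of "(X, K)" "(Y, K)" "(f, idt D K)" "(Z, K)" "(g, idt D K)"]
      arrow_idt[OF D K] category_idt_left[OF D arrow_idt[OF D K]] by simp
qed


section \<open>Simplicial sets\<close>

lemma sset_hom_app: "f \<in> sset_hom A B \<Longrightarrow> x \<in> fobj A n \<Longrightarrow> f n x \<in> fobj B n"
  by (auto simp: sset_hom_def PiE_iff)

lemma sset_hom_nat:
  "f \<in> sset_hom A B \<Longrightarrow> \<theta> \<in> hom simplex_cat m n \<Longrightarrow> x \<in> fobj A n \<Longrightarrow>
   f m (farr A n m \<theta> x) = farr B n m \<theta> (f n x)"
  by (auto simp: sset_hom_def)

lemma sset_hom_eqI: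
  assumes "f \<in> sset_hom A B" "g \<in> sset_hom A B"
    and "\<And>n x. x \<in> fobj A n \<Longrightarrow> f n x = g n x"
  shows "f = g"
  using assms unfolding sset_hom_def by (intro ext) (metis (no_types, lifting) PiE_ext mem_Collect_eq)

lemma sset_farr:
  assumes A: "is_sset U A" and \<theta>: "\<theta> \<in> hom simplex_cat m n" and x: "x \<in> fobj A n"
  shows "farr A n m \<theta> x \<in> fobj A m"
proof -
  have "is_arrow (op_cat simplex_cat) n m \<theta>"
    using \<theta> by (simp add: is_arrow_def simplex_cat_def)
  then have "farr A n m \<theta> \<in> hom (set_cat U) (fobj A n) (fobj A m)"
    using functor_hom[OF A[unfolded is_sset_def]] by simp
  with x show ?thesis by (auto simp: set_cat_def PiE_iff)
qed

lemma sset_comp_app [simp]: "x \<in> fobj A n \<Longrightarrow> sset_comp A g f n x = g n (f n x)"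
  by (simp add: sset_comp_def compose_def)

lemma sset_id_app [simp]: "x \<in> fobj A n \<Longrightarrow> sset_id A n x = x"
  by (simp add: sset_id_def)

text \<open>Valid for arbitrary families: \<open>sset_comp\<close> restricts to the simplices of A,
  so the equation of maps is purely elementwise and asks for no membership in
  \<open>sset_hom\<close>.\<close>

lemma sset_comp_eqI:
  "(\<And>n x. x \<in> fobj A n \<Longrightarrow> g n (f n x) = g' n (f' n x)) \<Longrightarrow> sset_comp A g f = sset_comp A g' f'"
  unfolding sset_comp_def compose_def by (intro ext restrict_ext) simp

lemma sset_comp_eqD:
  "sset_comp A g f = sset_comp A g' f' \<Longrightarrow> x \<in> fobj A n \<Longrightarrow> g n (f n x) = g' n (f' n x)"
  by (metis sset_comp_app)

lemma sset_id_hom: "is_sset U A \<Longrightarrow> sset_id A \<in> sset_hom A A"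
  unfolding sset_hom_def by (auto simp: sset_farr) (auto simp: sset_id_def)

text \<open>The domain is only required to be closed under its operators, because it will be a
  product with a standard simplex: its simplices live over another type, for which no universe has
  been chosen.\<close>

lemma sset_comp_hom_closed:
  assumes "\<And>m n \<theta> x. \<theta> \<in> hom simplex_cat m n \<Longrightarrow> x \<in> fobj A n \<Longrightarrow> farr A n m \<theta> x \<in> fobj A m"
    and "f \<in> sset_hom A B" "g \<in> sset_hom B C"
  shows "sset_comp A g f \<in> sset_hom A C"
  using assms unfolding sset_hom_def[of A C]
  by (auto simp: sset_hom_app sset_hom_nat) (auto simp: sset_comp_def compose_def)

lemma sset_comp_hom:
  "is_sset U A \<Longrightarrow> f \<in> sset_hom A B \<Longrightarrow> g \<in> sset_hom B C \<Longrightarrow> sset_comp A g f \<in> sset_hom A C"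
  by (rule sset_comp_hom_closed[OF sset_farr])

lemma sset_cat_simps [simp]:
  "obj (sset_cat U) = {A. is_sset U A}" "hom (sset_cat U) = sset_hom" "idt (sset_cat U) = sset_id"
  "cmp (sset_cat U) A B C g f = sset_comp A g f"
  by (simp_all add: sset_cat_def)

lemma is_arrow_sset [simp]:
  "is_arrow (sset_cat U) K L u \<longleftrightarrow> is_sset U K \<and> is_sset U L \<and> u \<in> sset_hom K L"
  by (simp add: is_arrow_def)

lemma category_sset_cat: "is_category (sset_cat U)"
proof -
  have "sset_comp A f (sset_id A) = f" "sset_comp A (sset_id B) f = f"
    if "is_sset U A" "is_sset U B" "f \<in> sset_hom A B" for A B :: "'a sset" and f
    using that by (auto intro!: sset_hom_eqI[of _ A B] sset_comp_hom[of U] sset_id_hom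
        simp: sset_hom_app)
  moreover have "sset_comp A (sset_comp B h g) f = sset_comp A h (sset_comp A g f)"
    if "f \<in> sset_hom A B" for A B :: "'a sset" and f g h
    using that by (intro sset_comp_eqI) (simp add: sset_hom_app)
  ultimately show ?thesis
    unfolding is_category_def by (auto intro: sset_id_hom sset_comp_hom)
qed

section \<open>Operators of the simplex category and simplices of the internal hom\<close>

lemma simplex_idt: "idt simplex_cat n \<in> hom simplex_cat n n"
  by (auto simp: simplex_cat_def mono_on_def)

lemma simplex_idt_right: "\<theta> \<in> hom simplex_cat m n \<Longrightarrow> cmp simplex_cat m m n \<theta> (idt simplex_cat m) = \<theta>"
  by (auto simp: simplex_cat_def compose_def PiE_iff extensional_def fun_eq_iff)

lemma sigma0_hom: "sigma0 n \<in> hom simplex_cat n 0"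
  by (auto simp: sigma0_def simplex_cat_def mono_on_def)

lemma hom_simplex_0: "hom simplex_cat n 0 = {sigma0 n}"
  by (auto simp: sigma0_def simplex_cat_def mono_on_def PiE_iff extensional_def fun_eq_iff)

lemma simplex_cmp:
  "\<theta> \<in> hom simplex_cat l m \<Longrightarrow> \<eta> \<in> hom simplex_cat m n \<Longrightarrow> cmp simplex_cat l m n \<eta> \<theta> \<in> hom simplex_cat l n"
  by (auto simp: simplex_cat_def compose_def PiE_iff mono_on_def)

lemma sset_prod_simps [simp]:
  "fobj (sset_prod A B) n = fobj A n \<times> fobj B n"
  "\<theta> \<in> hom simplex_cat m n \<Longrightarrow> a \<in> fobj A n \<Longrightarrow> b \<in> fobj B n \<Longrightarrow>
   farr (sset_prod A B) n m \<theta> (a, b) = (farr A n m \<theta> a, farr B n m \<theta> b)"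
  by (simp_all add: sset_prod_def)

lemma std_simplex_simps [simp]:
  "fobj (std_simplex n) m = hom simplex_cat m n"
  "\<theta> \<in> hom simplex_cat l m \<Longrightarrow> \<eta> \<in> hom simplex_cat m n \<Longrightarrow>
   farr (std_simplex n) m l \<theta> \<eta> = cmp simplex_cat l m n \<eta> \<theta>"
  by (simp_all add: std_simplex_def)

lemma fobj_ihom [simp]: "fobj (sset_ihom A B) n = sset_hom (sset_prod A (std_simplex n)) B"
  by (simp add: sset_ihom_def)

text \<open>The Yoneda step: a value at (x, \<theta>) can be read off \<theta>^*f at the identity,
  the only place where evaluation looks.\<close>

lemma farr_ihom:
  assumes "\<theta> \<in> hom simplex_cat m n" "f \<in> sset_hom (sset_prod A (std_simplex n)) B"
    and "x \<in> fobj A m"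
  shows "farr (sset_ihom A B) n m \<theta> f m (x, idt simplex_cat m) = f m (x, \<theta>)"
  using assms by (simp add: sset_ihom_def sset_map_prod_def std_simplex_map_def simplex_idt simplex_idt_right)

lemma ihom_eqI:
  assumes "f \<in> sset_hom (sset_prod A (std_simplex n)) B" "g \<in> sset_hom (sset_prod A (std_simplex n)) B"
    and "\<And>m x \<theta>. x \<in> fobj A m \<Longrightarrow> \<theta> \<in> hom simplex_cat m n \<Longrightarrow> f m (x, \<theta>) = g m (x, \<theta>)"
  shows "f = g"
  using assms by (intro sset_hom_eqI) auto

lemma prod_simplex_farr:
  assumes "is_sset U A" "\<theta> \<in> hom simplex_cat l m" "z \<in> fobj (sset_prod A (std_simplex n)) m"
  shows "farr (sset_prod A (std_simplex n)) m l \<theta> z \<in> fobj (sset_prod A (std_simplex n)) l"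
  using assms by (cases z) (simp add: sset_farr simplex_cmp)

lemma ihom_pre_app:
  "f \<in> sset_hom (sset_prod A (std_simplex n)) B \<Longrightarrow> x \<in> fobj C m \<Longrightarrow> \<theta> \<in> hom simplex_cat m n \<Longrightarrow>
   sset_ihom_pre C A B u n f m (x, \<theta>) = f m (u m x, \<theta>)"
  by (simp add: sset_ihom_pre_def sset_map_prod_def)

lemma ihom_pre_in:
  assumes C: "is_sset U C" and u: "u \<in> sset_hom C A"
    and f: "f \<in> sset_hom (sset_prod A (std_simplex n)) B"
  shows "sset_ihom_pre C A B u n f \<in> sset_hom (sset_prod C (std_simplex n)) B"
proof -
  have "sset_map_prod C (std_simplex n) u (sset_id (std_simplex n)) \<in>
      sset_hom (sset_prod C (std_simplex n)) (sset_prod A (std_simplex n))"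
    by (auto simp: sset_hom_def[of "sset_prod C (std_simplex n)"] sset_map_prod_def
        sset_hom_app[OF u] sset_hom_nat[OF u] sset_farr[OF C] simplex_cmp)
  then show ?thesis
    using sset_comp_hom_closed[OF prod_simplex_farr[OF C] _ f] f by (simp add: sset_ihom_pre_def)
qed

lemma ihom_post_app:
  "f \<in> sset_hom (sset_prod A (std_simplex n)) B \<Longrightarrow> x \<in> fobj A m \<Longrightarrow> \<theta> \<in> hom simplex_cat m n \<Longrightarrow>
   sset_ihom_post A B u n f m (x, \<theta>) = u m (f m (x, \<theta>))"
  by (simp add: sset_ihom_post_def)

lemma ihom_post_in:
  assumes A: "is_sset U A" and u: "u \<in> sset_hom B C"
    and f: "f \<in> sset_hom (sset_prod A (std_simplex n)) B"
  shows "sset_ihom_post A B u n f \<in> sset_hom (sset_prod A (std_simplex n)) C"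
  using sset_comp_hom_closed[OF prod_simplex_farr[OF A] f u] f by (simp add: sset_ihom_post_def)

text \<open>The isomorphism \<open>A \<times> \<Delta>[0] \<cong> A\<close>, read on maps out of both sides.\<close>

lemma bij_betw_vertex_ihom:
  assumes A: "is_sset U A"
  shows "bij_betw (\<lambda>f. \<lambda>m. \<lambda>x \<in> fobj A m. f m (x, sigma0 m))
    (sset_hom (sset_prod A (std_simplex 0)) B) (sset_hom A B)"
proof (rule bij_betw_byWitness[where f' = "\<lambda>v m. \<lambda>z \<in> fobj A m \<times> hom simplex_cat m 0. v m (fst z)"])
  \<comment> \<open>[0] is terminal in the simplex category, so every operator preserves the
    simplices \<open>sigma0\<close>.\<close>
  have cmp0: "cmp simplex_cat l m 0 (sigma0 m) \<theta> = sigma0 l" if "\<theta> \<in> hom simplex_cat l m" for l m \<theta>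
    using simplex_cmp[OF that sigma0_hom] by (simp add: hom_simplex_0)
  show "(\<lambda>f m. \<lambda>x \<in> fobj A m. f m (x, sigma0 m)) ` sset_hom (sset_prod A (std_simplex 0)) B \<subseteq> sset_hom A B"
  proof (rule image_subsetI)
    fix f assume f: "f \<in> sset_hom (sset_prod A (std_simplex 0)) B"
    have "f m (farr A n m \<theta> x, sigma0 m) = farr B n m \<theta> (f n (x, sigma0 n))"
      if "\<theta> \<in> hom simplex_cat m n" "x \<in> fobj A n" for m n \<theta> x
      using sset_hom_nat[OF f that(1), of "(x, sigma0 n)"] that by (simp add: sigma0_hom cmp0)
    moreover have "f n (x, sigma0 n) \<in> fobj B n" if "x \<in> fobj A n" for n x
      using that by (intro sset_hom_app[OF f]) (simp add: sigma0_hom)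
    ultimately show "(\<lambda>m. \<lambda>x \<in> fobj A m. f m (x, sigma0 m)) \<in> sset_hom A B"
      using sset_farr[OF A] by (simp add: sset_hom_def)
  qed
  show "(\<lambda>v m. \<lambda>z \<in> fobj A m \<times> hom simplex_cat m 0. v m (fst z)) ` sset_hom A B
      \<subseteq> sset_hom (sset_prod A (std_simplex 0)) B"
    by (auto simp: sset_hom_def[of "sset_prod A (std_simplex 0)"] sset_hom_app sset_hom_nat
        sset_farr[OF A] simplex_cmp split: if_splits)
  show "\<forall>v \<in> sset_hom A B. (\<lambda>m. \<lambda>x \<in> fobj A m.
      (\<lambda>z \<in> fobj A m \<times> hom simplex_cat m 0. v m (fst z)) (x, sigma0 m)) = v"
    by (auto simp: sset_hom_def PiE_iff extensional_def sigma0_hom fun_eq_iff)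
  show "\<forall>f \<in> sset_hom (sset_prod A (std_simplex 0)) B.
      (\<lambda>m. \<lambda>z \<in> fobj A m \<times> hom simplex_cat m 0. (\<lambda>x \<in> fobj A m. f m (x, sigma0 m)) (fst z)) = f"
  proof (intro ballI ext)
    fix f m z assume "f \<in> sset_hom (sset_prod A (std_simplex 0)) B"
    \<comment> \<open>Inside the domain the second component of z can only be
      \<open>sigma0 m\<close>; outside it both sides are \<open>undefined\<close>.\<close>
    then show "(\<lambda>z \<in> fobj A m \<times> hom simplex_cat m 0. (\<lambda>x \<in> fobj A m. f m (x, sigma0 m)) (fst z)) z = f m z"
      by (cases z; cases "z \<in> fobj A m \<times> hom simplex_cat m 0")
        (auto simp: sset_hom_def PiE_iff extensional_def hom_simplex_0)
  qed
qed

lemma sset_iso_bij: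
  assumes "sset_iso A B f"
  shows "bij_betw (f n) (fobj A n) (fobj B n)"
proof -
  from assms obtain g where g: "f \<in> sset_hom A B" "g \<in> sset_hom B A"
    "sset_comp A g f = sset_id A" "sset_comp B f g = sset_id B"
    by (auto simp: sset_iso_def)
  then have "\<forall>x \<in> fobj A n. g n (f n x) = x" "\<forall>y \<in> fobj B n. f n (g n y) = y"
    by (metis sset_comp_app sset_id_app)+
  with g(1,2) show ?thesis
    by (intro bij_betw_byWitness[where f' = "g n"]) (auto simp: sset_hom_app)
qed


section \<open>Simplicial categories\<close>

locale simplicial_category =
  fixes U :: "'a set set" and S :: "('o, 'm, 'a) simp_cat"
  assumes simplicial: "is_simplicial_category U S"
begin

lemma category: "is_category S"
  using simplicial by (simp add: is_simplicial_category_def)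

lemma functor_enr: "is_functor (prod_cat (op_cat S) S) (sset_cat U) (enr S)"
  using simplicial by (simp add: is_simplicial_category_def)

lemma sset_Map: "X \<in> obj S \<Longrightarrow> Y \<in> obj S \<Longrightarrow> is_sset U (Map S X Y)"
  using functor_obj[OF functor_enr, of "(X, Y)"] by (simp add: Map_def)

lemma scmp_hom:
  "X \<in> obj S \<Longrightarrow> Y \<in> obj S \<Longrightarrow> Z \<in> obj S \<Longrightarrow>
   scmp S X Y Z \<in> sset_hom (sset_prod (Map S X Y) (Map S Y Z)) (Map S X Z)"
  using simplicial by (simp add: is_simplicial_category_def)

lemma scmp_in:
  "X \<in> obj S \<Longrightarrow> Y \<in> obj S \<Longrightarrow> Z \<in> obj S \<Longrightarrow> f \<in> fobj (Map S X Y) n \<Longrightarrow> g \<in> fobj (Map S Y Z) n \<Longrightarrow>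
   scmp S X Y Z n (f, g) \<in> fobj (Map S X Z) n"
  using sset_hom_app[OF scmp_hom, where x = "(f, g)"] by simp

lemma tld_bij: "X \<in> obj S \<Longrightarrow> Y \<in> obj S \<Longrightarrow> bij_betw (tld S X Y) (hom S X Y) (fobj (Map S X Y) 0)"
  using simplicial by (simp add: is_simplicial_category_def)

lemma scmp_assoc:
  "X \<in> obj S \<Longrightarrow> Y \<in> obj S \<Longrightarrow> Z \<in> obj S \<Longrightarrow> W \<in> obj S \<Longrightarrow>
   f \<in> fobj (Map S X Y) n \<Longrightarrow> g \<in> fobj (Map S Y Z) n \<Longrightarrow> h \<in> fobj (Map S Z W) n \<Longrightarrow>
   scmp S X Y W n (f, scmp S Y Z W n (g, h)) = scmp S X Z W n (scmp S X Y Z n (f, g), h)"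
  using simplicial by (simp add: is_simplicial_category_def)

lemma Map_post_eq:
  "X \<in> obj S \<Longrightarrow> is_arrow S Y Z g \<Longrightarrow> f \<in> fobj (Map S X Y) n \<Longrightarrow>
   Map_post S X Y Z g n f = scmp S X Y Z n (f, degen S Y Z n g)"
  using simplicial by (simp add: is_simplicial_category_def is_arrow_def)

lemma Map_pre_eq:
  "is_arrow S X Y f \<Longrightarrow> Z \<in> obj S \<Longrightarrow> g \<in> fobj (Map S Y Z) n \<Longrightarrow>
   Map_pre S X Y Z f n g = scmp S X Y Z n (degen S X Y n f, g)"
  using simplicial by (simp add: is_simplicial_category_def is_arrow_def)

lemma degen_in: "is_arrow S X Y f \<Longrightarrow> degen S X Y n f \<in> fobj (Map S X Y) n"
  unfolding degen_def is_arrow_def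
  by (auto intro!: sset_farr[OF sset_Map] sigma0_hom bij_betw_apply[OF tld_bij])

lemma arrow_obj: "is_arrow S X Y f \<Longrightarrow> X \<in> obj S" "is_arrow S X Y f \<Longrightarrow> Y \<in> obj S"
  by (simp_all add: is_arrow_def)

section \<open>The functors S(X,-) and S(-,Z) on simplices, and their exchange with
  composition\<close>

lemma Map_post_hom:
  "X \<in> obj S \<Longrightarrow> is_arrow S Y Z g \<Longrightarrow> Map_post S X Y Z g \<in> sset_hom (Map S X Y) (Map S X Z)"
  using functor_hom[OF functor_enr, of "(X, Y)" "(X, Z)" "(idt S X, g)"] arrow_idt[OF category]
  by (simp add: Map_def Map_post_def)

lemma Map_pre_hom:
  "is_arrow S X Y f \<Longrightarrow> Z \<in> obj S \<Longrightarrow> Map_pre S X Y Z f \<in> sset_hom (Map S Y Z) (Map S X Z)"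
  using functor_hom[OF functor_enr, of "(Y, Z)" "(X, Z)" "(f, idt S Z)"] arrow_idt[OF category]
  by (simp add: Map_def Map_pre_def)

lemma Map_post_idt:
  "X \<in> obj S \<Longrightarrow> Y \<in> obj S \<Longrightarrow> x \<in> fobj (Map S X Y) n \<Longrightarrow> Map_post S X Y Y (idt S Y) n x = x"
  using functor_idt[OF functor_enr, of "(X, Y)"] by (simp add: Map_def Map_post_def)

lemma Map_pre_idt:
  "X \<in> obj S \<Longrightarrow> Y \<in> obj S \<Longrightarrow> x \<in> fobj (Map S X Y) n \<Longrightarrow> Map_pre S X X Y (idt S X) n x = x"
  using functor_idt[OF functor_enr, of "(X, Y)"] by (simp add: Map_def Map_pre_def)

text \<open>Taken from functoriality (S1). Going through (S5) instead would require knowing that the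
  degenerate simplex of a composite is the composite of the degenerate simplices.\<close>

lemma Map_post_cmp:
  assumes "X \<in> obj S" "is_arrow S Y Z g" "is_arrow S Z W h" "x \<in> fobj (Map S X Y) n"
  shows "Map_post S X Y W (cmp S Y Z W h g) n x = Map_post S X Z W h n (Map_post S X Y Z g n x)"
  using functor_cmp[OF functor_enr, of "(X, Y)" "(X, Z)" "(idt S X, g)" "(X, W)" "(idt S X, h)"]
    arrow_idt[OF category assms(1)] category_idt_left[OF category arrow_idt[OF category assms(1)]] assms
  by (simp add: Map_def Map_post_def)

lemma Map_pre_cmp:
  assumes "W \<in> obj S" "is_arrow S X Y f" "is_arrow S Y Z g" "x \<in> fobj (Map S Z W) n"
  shows "Map_pre S X Z W (cmp S X Y Z g f) n x = Map_pre S X Y W f n (Map_pre S Y Z W g n x)"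
  using functor_cmp[OF functor_enr, of "(Z, W)" "(Y, W)" "(g, idt S W)" "(X, W)" "(f, idt S W)"]
    arrow_idt[OF category assms(1)] category_idt_left[OF category arrow_idt[OF category assms(1)]] assms
  by (simp add: Map_def Map_pre_def)

text \<open>By (S5) both sides are the degenerate f, then x, then the degenerate g, in the two
  bracketings that (S4) identifies. The next three rules have the same reason.\<close>

lemma Map_post_pre:
  assumes "is_arrow S X Y f" "is_arrow S Z W g" "x \<in> fobj (Map S Y Z) n"
  shows "Map_post S X Z W g n (Map_pre S X Y Z f n x) = Map_pre S X Y W f n (Map_post S Y Z W g n x)"
  using assms arrow_obj[OF assms(1)] arrow_obj[OF assms(2)]
  by (simp add: Map_post_eq Map_pre_eq degen_in scmp_in scmp_assoc)

lemma scmp_post_right: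
  assumes "X \<in> obj S" "Y \<in> obj S" "is_arrow S Z W g" "x \<in> fobj (Map S X Y) n" "y \<in> fobj (Map S Y Z) n"
  shows "scmp S X Y W n (x, Map_post S Y Z W g n y) = Map_post S X Z W g n (scmp S X Y Z n (x, y))"
  using assms arrow_obj[OF assms(3)] by (simp add: Map_post_eq degen_in scmp_in scmp_assoc)

text \<open>Here the degenerate g sits between x and y and is shifted from one factor to the other.
  This is how a morphism out of X \<otimes> K comes to act on \<alpha>.\<close>

lemma scmp_pre_right:
  assumes "X \<in> obj S" "is_arrow S Y Z g" "W \<in> obj S" "x \<in> fobj (Map S X Y) n" "y \<in> fobj (Map S Z W) n"
  shows "scmp S X Y W n (x, Map_pre S Y Z W g n y) = scmp S X Z W n (Map_post S X Y Z g n x, y)"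
  using assms arrow_obj[OF assms(2)] by (simp add: Map_post_eq Map_pre_eq degen_in scmp_in scmp_assoc)

lemma scmp_pre_left:
  assumes "is_arrow S X Y f" "Z \<in> obj S" "W \<in> obj S" "x \<in> fobj (Map S Y Z) n" "y \<in> fobj (Map S Z W) n"
  shows "scmp S X Z W n (Map_pre S X Y Z f n x, y) = Map_pre S X Y W f n (scmp S Y Z W n (x, y))"
  using assms arrow_obj[OF assms(1)] by (simp add: Map_pre_eq degen_in scmp_in scmp_assoc)

end


section \<open>Cylinders\<close>

context simplicial_category
begin

lemma cylinder_obj: "is_cylinder S X K c \<Longrightarrow> cyl_obj c \<in> obj S"
  by (simp add: is_cylinder_def Let_def)

lemma cylinder_map: "is_cylinder S X K c \<Longrightarrow> cyl_map c \<in> sset_hom K (Map S X (cyl_obj c))"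
  by (simp add: is_cylinder_def Let_def)

lemma cylinder_iso:
  "is_cylinder S X K c \<Longrightarrow> Y \<in> obj S \<Longrightarrow>
   sset_iso (Map S (cyl_obj c) Y) (sset_ihom K (Map S X Y)) (cyl_iso c Y)"
  by (simp add: is_cylinder_def Let_def)

lemma cylinder_iso_in:
  "is_cylinder S X K c \<Longrightarrow> Y \<in> obj S \<Longrightarrow> h \<in> fobj (Map S (cyl_obj c) Y) n \<Longrightarrow>
   cyl_iso c Y n h \<in> sset_hom (sset_prod K (std_simplex n)) (Map S X Y)"
  using bij_betw_apply[OF sset_iso_bij[OF cylinder_iso]] by fastforce

lemma cylinder_iso_ev:
  assumes c: "is_cylinder S X K c" and Y: "Y \<in> obj S"
    and k: "k \<in> fobj K n" and h: "h \<in> fobj (Map S (cyl_obj c) Y) n"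
  shows "cyl_iso c Y n h n (k, idt simplex_cat n) = scmp S X (cyl_obj c) Y n (cyl_map c n k, h)"
proof -
  let ?P = "sset_prod K (Map S (cyl_obj c) Y)"
  have "sset_comp ?P (sset_ev K (Map S X Y))
      (sset_map_prod K (Map S (cyl_obj c) Y) (sset_id K) (cyl_iso c Y)) =
    sset_comp ?P (scmp S X (cyl_obj c) Y)
      (sset_map_prod K (Map S (cyl_obj c) Y) (cyl_map c) (sset_id (Map S (cyl_obj c) Y)))"
    using c Y by (simp add: is_cylinder_def Let_def)
  from sset_comp_eqD[OF this, of "(k, h)" n] show ?thesis
    using k h cylinder_iso_in[OF c Y h] by (simp add: sset_map_prod_def sset_ev_def)
qed

text \<open>The evaluation equation only describes \<open>\<phi>\<close> at identities of \<open>\<Delta>\<close>; by Yoneda it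
  determines \<open>\<phi>\<close> completely.\<close>

lemma cylinder_iso_app:
  assumes X: "X \<in> obj S" and c: "is_cylinder S X K c" and Y: "Y \<in> obj S"
    and h: "h \<in> fobj (Map S (cyl_obj c) Y) n" and k: "k \<in> fobj K m"
    and \<theta>: "\<theta> \<in> hom simplex_cat m n"
  shows "cyl_iso c Y n h m (k, \<theta>) =
    scmp S X (cyl_obj c) Y m (cyl_map c m k, farr (Map S (cyl_obj c) Y) n m \<theta> h)"
proof -
  have "cyl_iso c Y n h m (k, \<theta>) =
      farr (sset_ihom K (Map S X Y)) n m \<theta> (cyl_iso c Y n h) m (k, idt simplex_cat m)"
    using farr_ihom[OF \<theta> cylinder_iso_in[OF c Y h] k] by simp
  \<comment> \<open>\<phi> is a simplicial map, so the operator moves onto h; the simplex is then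
    evaluated at an identity, where the defining equation applies.\<close>
  also have "\<dots> = cyl_iso c Y m (farr (Map S (cyl_obj c) Y) n m \<theta> h) m (k, idt simplex_cat m)"
    using cylinder_iso[OF c Y] sset_hom_nat[OF _ \<theta> h] by (fastforce simp: sset_iso_def)
  also have "\<dots> = scmp S X (cyl_obj c) Y m (cyl_map c m k, farr (Map S (cyl_obj c) Y) n m \<theta> h)"
    by (intro cylinder_iso_ev[OF c Y k] sset_farr[OF sset_Map \<theta> h] cylinder_obj[OF c] Y)
  finally show ?thesis .
qed

text \<open>The bijection is a composite of three: morphisms to vertices, \<phi> on vertices, and
  the identification of maps out of K \<times> \<Delta>[0] with maps out of K. It has the stated
  formula because \<phi> of the vertex of g at (k, \<open>sigma0 m\<close>) is the degenerate g
  composed with \<alpha>(k), which (S5) recognises as S(X,g) at \<alpha>(k).\<close>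

lemma cylinder_transpose_bij:
  assumes X: "X \<in> obj S" and K: "is_sset U K" and c: "is_cylinder S X K c" and Y: "Y \<in> obj S"
  shows "bij_betw (\<lambda>g. sset_comp K (Map_post S X (cyl_obj c) Y g) (cyl_map c))
    (hom S (cyl_obj c) Y) (sset_hom K (Map S X Y))"
proof -
  let ?XK = "cyl_obj c"
  note XK = cylinder_obj[OF c]
  let ?r = "\<lambda>f. \<lambda>m. \<lambda>x \<in> fobj K m. f m (x, sigma0 m)"
  have "bij_betw (cyl_iso c Y 0) (fobj (Map S ?XK Y) 0) (sset_hom (sset_prod K (std_simplex 0)) (Map S X Y))"
    using sset_iso_bij[OF cylinder_iso[OF c Y]] by simp
  then have bij: "bij_betw (?r \<circ> (cyl_iso c Y 0 \<circ> tld S ?XK Y)) (hom S ?XK Y) (sset_hom K (Map S X Y))"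
    using bij_betw_trans[OF bij_betw_trans[OF tld_bij[OF XK Y]] bij_betw_vertex_ihom[OF K]] by blast
  have "(?r \<circ> (cyl_iso c Y 0 \<circ> tld S ?XK Y)) g = sset_comp K (Map_post S X ?XK Y g) (cyl_map c)"
    if g: "g \<in> hom S ?XK Y" for g
  proof (intro ext)
    fix m k
    have "is_arrow S ?XK Y g" using g XK Y by (simp add: is_arrow_def)
    then show "(?r \<circ> (cyl_iso c Y 0 \<circ> tld S ?XK Y)) g m k =
        sset_comp K (Map_post S X ?XK Y g) (cyl_map c) m k"
      using cylinder_iso_app[OF X c Y _ _ sigma0_hom] bij_betw_apply[OF tld_bij[OF XK Y] g]
        sset_hom_app[OF cylinder_map[OF c]] X
      by (cases "k \<in> fobj K m") (simp_all add: Map_post_eq degen_def sset_comp_def compose_def)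
  qed
  with bij show ?thesis by (subst bij_betw_cong[symmetric]) auto
qed

text \<open>Injectivity of the transpose, and in the next lemma its surjectivity, in the elementwise
  form needed for uniqueness and existence of \<open>induced\<close> morphisms.\<close>

lemma cylinder_arrow_eqI:
  assumes "X \<in> obj S" "is_sset U K" "is_cylinder S X K c"
    and "is_arrow S (cyl_obj c) Y g" "is_arrow S (cyl_obj c) Y h"
    and "\<And>n k. k \<in> fobj K n \<Longrightarrow>
      Map_post S X (cyl_obj c) Y g n (cyl_map c n k) = Map_post S X (cyl_obj c) Y h n (cyl_map c n k)"
  shows "g = h"
proof (rule inj_onD[OF bij_betw_imp_inj_on[OF cylinder_transpose_bij[OF assms(1-3), of Y]]])
  show "sset_comp K (Map_post S X (cyl_obj c) Y g) (cyl_map c) =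
      sset_comp K (Map_post S X (cyl_obj c) Y h) (cyl_map c)"
    by (intro sset_comp_eqI assms(6))
qed (use assms(4,5) in \<open>auto simp: is_arrow_def\<close>)

lemma cylinder_arrow_ex:
  assumes "X \<in> obj S" "is_sset U K" "is_cylinder S X K c" "Y \<in> obj S" "v \<in> sset_hom K (Map S X Y)"
  shows "\<exists>g \<in> hom S (cyl_obj c) Y. \<forall>n. \<forall>k \<in> fobj K n.
    Map_post S X (cyl_obj c) Y g n (cyl_map c n k) = v n k"
proof -
  have "v \<in> (\<lambda>g. sset_comp K (Map_post S X (cyl_obj c) Y g) (cyl_map c)) ` hom S (cyl_obj c) Y"
    using bij_betw_imp_surj_on[OF cylinder_transpose_bij[OF assms(1-4)]] assms(5) by simp
  then show ?thesis by force
qed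

end


section \<open>The tensor functor\<close>

locale tensored_category = simplicial_category U S
  for U :: "'a set set" and S :: "('o, 'm, 'a) simp_cat" +
  fixes c :: "'o \<Rightarrow> 'a sset \<Rightarrow> ('o, 'a) cylinder"
  assumes choice: "cylinder_choice U S c"
begin

abbreviation ten :: "'o \<Rightarrow> 'a sset \<Rightarrow> 'o" where
  "ten X K \<equiv> cyl_obj (c X K)"

abbreviation \<alpha> :: "'o \<Rightarrow> 'a sset \<Rightarrow> ('a, 'a) smap" where
  "\<alpha> X K \<equiv> cyl_map (c X K)"

lemma cyl: "X \<in> obj S \<Longrightarrow> is_sset U K \<Longrightarrow> is_cylinder S X K (c X K)"
  using choice by (simp add: cylinder_choice_def)

lemma ten_obj: "X \<in> obj S \<Longrightarrow> is_sset U K \<Longrightarrow> ten X K \<in> obj S"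
  using cylinder_obj[OF cyl] .

lemma \<alpha>_in: "X \<in> obj S \<Longrightarrow> is_sset U K \<Longrightarrow> k \<in> fobj K n \<Longrightarrow> \<alpha> X K n k \<in> fobj (Map S X (ten X K)) n"
  using sset_hom_app[OF cylinder_map[OF cyl]] .

text \<open>The equation that characterises f \<otimes> u for a joint arrow (f, u); taking f or u to
  be an identity recovers the two equations of \<open>is_tensor_functor\<close>. It is a relation on
  pairs so that its solution can serve as the arrow map of a functor on the product
  category.\<close>

definition induced :: "'o \<times> 'a sset \<Rightarrow> 'o \<times> 'a sset \<Rightarrow> 'm \<times> ('a, 'a) smap \<Rightarrow> 'm \<Rightarrow> bool" where
  "induced = (\<lambda>(X, K) (Y, L) (f, u) t. is_arrow S (ten X K) (ten Y L) t \<and>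
     (\<forall>n. \<forall>k \<in> fobj K n. Map_post S X (ten X K) (ten Y L) t n (\<alpha> X K n k) =
        Map_pre S X Y (ten Y L) f n (\<alpha> Y L n (u n k))))"

lemma inducedI:
  assumes "is_arrow S (ten X K) (ten Y L) t"
    and "\<And>n k. k \<in> fobj K n \<Longrightarrow> Map_post S X (ten X K) (ten Y L) t n (\<alpha> X K n k) =
        Map_pre S X Y (ten Y L) f n (\<alpha> Y L n (u n k))"
  shows "induced (X, K) (Y, L) (f, u) t"
  using assms by (simp add: induced_def)

lemma inducedD:
  assumes "induced (X, K) (Y, L) (f, u) t"
  shows "is_arrow S (ten X K) (ten Y L) t"
    and "k \<in> fobj K n \<Longrightarrow> Map_post S X (ten X K) (ten Y L) t n (\<alpha> X K n k) =
        Map_pre S X Y (ten Y L) f n (\<alpha> Y L n (u n k))"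
  using assms by (simp_all add: induced_def)

text \<open>The right-hand side of the equation is a simplicial map from K to S(X, Y \<otimes> L),
  hence the transpose of exactly one morphism out of X \<otimes> K.\<close>

lemma induced_ex1:
  assumes "is_arrow (prod_cat S (sset_cat U)) p q w"
  shows "\<exists>!t. induced p q w t"
proof -
  obtain X K Y L f u where pq: "p = (X, K)" "q = (Y, L)" "w = (f, u)"
    by (metis surj_pair)
  with assms have f: "is_arrow S X Y f" and K: "is_sset U K" and L: "is_sset U L"
    and u: "u \<in> sset_hom K L" by auto
  note ob = arrow_obj[OF f]
  have "sset_comp K (Map_pre S X Y (ten Y L) f) (sset_comp K (\<alpha> Y L) u) \<in> sset_hom K (Map S X (ten Y L))"
    using ob K L u f
    by (intro sset_comp_hom[OF K sset_comp_hom[OF K u cylinder_map[OF cyl]]] Map_pre_hom ten_obj)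
  from cylinder_arrow_ex[OF ob(1) K cyl[OF ob(1) K] ten_obj[OF ob(2) L] this]
  have "\<exists>t. induced p q w t"
    unfolding pq using ob K L by (auto intro!: inducedI simp: is_arrow_def ten_obj)
  moreover have "t = t'" if "induced p q w t" "induced p q w t'" for t t'
    using that unfolding pq
    by (intro cylinder_arrow_eqI[OF ob(1) K cyl[OF ob(1) K], of "ten Y L"]) (auto simp: inducedD)
  ultimately show ?thesis by blast
qed

lemma induced_idt:
  assumes "X \<in> obj S" "is_sset U K"
  shows "induced (X, K) (X, K) (idt S X, sset_id K) (idt S (ten X K))"
  using assms by (intro inducedI arrow_idt[OF category])
    (simp_all add: ten_obj Map_post_idt Map_pre_idt \<alpha>_in)

text \<open>The two squares are pasted along \<open>Map_post_pre\<close>, which lets S(-,t) pass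
  S(f,-) so that the equation for t becomes applicable.\<close>

lemma induced_cmp:
  assumes f: "is_arrow S X Y f" and g: "is_arrow S Y Z g"
    and K: "is_sset U K" and L: "is_sset U L" and M: "is_sset U M"
    and u: "u \<in> sset_hom K L" and v: "v \<in> sset_hom L M"
    and s: "induced (X, K) (Y, L) (f, u) s" and t: "induced (Y, L) (Z, M) (g, v) t"
  shows "induced (X, K) (Z, M) (cmp S X Y Z g f, sset_comp K v u)
    (cmp S (ten X K) (ten Y L) (ten Z M) t s)"
proof (rule inducedI)
  note ob = arrow_obj[OF f] arrow_obj(2)[OF g]
  note st = inducedD(1)[OF s] inducedD(1)[OF t]
  show "is_arrow S (ten X K) (ten Z M) (cmp S (ten X K) (ten Y L) (ten Z M) t s)"
    by (rule arrow_cmp[OF category st])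
  fix n k assume k: "k \<in> fobj K n"
  have uk: "u n k \<in> fobj L n" by (rule sset_hom_app[OF u k])
  have vuk: "v n (u n k) \<in> fobj M n" by (rule sset_hom_app[OF v uk])
  have "Map_post S X (ten X K) (ten Z M) (cmp S (ten X K) (ten Y L) (ten Z M) t s) n (\<alpha> X K n k) =
      Map_post S X (ten Y L) (ten Z M) t n (Map_pre S X Y (ten Y L) f n (\<alpha> Y L n (u n k)))"
    using Map_post_cmp[OF ob(1) st \<alpha>_in[OF ob(1) K k]] inducedD(2)[OF s k] by simp
  also have "\<dots> = Map_pre S X Y (ten Z M) f n (Map_pre S Y Z (ten Z M) g n (\<alpha> Z M n (v n (u n k))))"
    using Map_post_pre[OF f st(2) \<alpha>_in[OF ob(2) L uk]] inducedD(2)[OF t uk] by simp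
  also have "\<dots> = Map_pre S X Z (ten Z M) (cmp S X Y Z g f) n (\<alpha> Z M n (v n (u n k)))"
    using Map_pre_cmp[OF ten_obj[OF ob(3) M] f g \<alpha>_in[OF ob(3) M vuk]] by simp
  finally show "Map_post S X (ten X K) (ten Z M) (cmp S (ten X K) (ten Y L) (ten Z M) t s) n (\<alpha> X K n k) =
      Map_pre S X Z (ten Z M) (cmp S X Y Z g f) n (\<alpha> Z M n (sset_comp K v u n k))"
    using k by simp
qed

text \<open>Factoring (f, u) as (f, id) after (id, u) reduces the joint equation to the two separate
  ones that T satisfies. Together with \<open>induced_ex1\<close> this pins down T on all
  arrows.\<close>

lemma tensor_functor_induced:
  assumes T: "is_tensor_functor U S c T" and f: "is_arrow S X Y f"
    and K: "is_sset U K" and L: "is_sset U L" and u: "u \<in> sset_hom K L"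
  shows "induced (X, K) (Y, L) (f, u) (farr T (X, K) (Y, L) (f, u))"
proof -
  note ob = arrow_obj[OF f]
  have fobj: "fobj T (X, K) = ten X K" if "X \<in> obj S" "is_sset U K" for X K
    using T that by (auto simp: is_tensor_functor_def)
  have F: "is_functor (prod_cat S (sset_cat U)) S T"
    using T by (simp add: is_tensor_functor_def)
  note idX = arrow_idt[OF category ob(1)] and idL = sset_id_hom[OF L]
  have a: "induced (X, K) (X, L) (idt S X, u) (farr T (X, K) (X, L) (idt S X, u))"
  proof (rule inducedI)
    show "is_arrow S (ten X K) (ten X L) (farr T (X, K) (X, L) (idt S X, u))"
      using functor_arrow[OF F, of "(X, K)" "(X, L)" "(idt S X, u)"] idX K L u fobj ob by simp
    fix n k assume k: "k \<in> fobj K n"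
    have "sset_comp K (Map_post S X (ten X K) (ten X L) (farr T (X, K) (X, L) (idt S X, u))) (\<alpha> X K) =
        sset_comp K (\<alpha> X L) u"
      using T ob K L u by (simp add: is_tensor_functor_def)
    from sset_comp_eqD[OF this k]
    show "Map_post S X (ten X K) (ten X L) (farr T (X, K) (X, L) (idt S X, u)) n (\<alpha> X K n k) =
        Map_pre S X X (ten X L) (idt S X) n (\<alpha> X L n (u n k))"
      using ob L sset_hom_app[OF u k] by (simp add: Map_pre_idt ten_obj \<alpha>_in)
  qed
  have b: "induced (X, L) (Y, L) (f, sset_id L) (farr T (X, L) (Y, L) (f, sset_id L))"
  proof (rule inducedI)
    show "is_arrow S (ten X L) (ten Y L) (farr T (X, L) (Y, L) (f, sset_id L))"
      using functor_arrow[OF F, of "(X, L)" "(Y, L)" "(f, sset_id L)"] f L idL fobj ob by simp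
    fix n k assume k: "k \<in> fobj L n"
    have "sset_comp L (Map_post S X (ten X L) (ten Y L) (farr T (X, L) (Y, L) (f, sset_id L))) (\<alpha> X L) =
        sset_comp L (Map_pre S X Y (ten Y L) f) (\<alpha> Y L)"
      using T f L by (simp add: is_tensor_functor_def)
    from sset_comp_eqD[OF this k]
    show "Map_post S X (ten X L) (ten Y L) (farr T (X, L) (Y, L) (f, sset_id L)) n (\<alpha> X L n k) =
        Map_pre S X Y (ten Y L) f n (\<alpha> Y L n (sset_id L n k))"
      using k by simp
  qed
  have "farr T (X, K) (Y, L) (cmp S X X Y f (idt S X), sset_comp K (sset_id L) u) =
      cmp S (ten X K) (ten X L) (ten Y L) (farr T (X, L) (Y, L) (f, sset_id L))
        (farr T (X, K) (X, L) (idt S X, u))"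
    using functor_cmp[OF F, of "(X, K)" "(X, L)" "(idt S X, u)" "(Y, L)" "(f, sset_id L)"]
      f idX K L u idL ob fobj by simp
  moreover have "cmp S X X Y f (idt S X) = f" "sset_comp K (sset_id L) u = u"
    using category_idt_right[OF category f] category_idt_left[OF category_sset_cat[of U], of K L u] K L u
    by simp_all
  ultimately show ?thesis
    using induced_cmp[OF idX f K L L u idL a b] by simp
qed

lemma tensor_functor_ex1: "\<exists>!T. is_tensor_functor U S c T"
proof (rule ex_ex1I)
  \<comment> \<open>The value on an arrow is the unique solution of \<open>induced\<close>. A
    functor law then only asks that its right-hand side solve the same equation, which is
    \<open>induced_idt\<close> or \<open>induced_cmp\<close>.\<close>
  define T where "T = mk_functor (prod_cat S (sset_cat U)) (\<lambda>(X, K). ten X K) (\<lambda>p q w. THE t. induced p q w t)"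
  have T: "induced (X, K) (Y, L) (f, u) (THE t. induced (X, K) (Y, L) (f, u) t)"
    if "is_arrow S X Y f" "is_sset U K" "is_sset U L" "u \<in> sset_hom K L" for X Y K L f u
    using that by (intro theI'[OF induced_ex1]) simp
  have the_eq: "(THE t. induced p q w t) = t"
    if "is_arrow (prod_cat S (sset_cat U)) p q w" "induced p q w t" for p q w t
    using that by (rule the1_equality[OF induced_ex1])
  have "is_functor (prod_cat S (sset_cat U)) S T"
    unfolding T_def
  proof (rule is_functor_mk_functor[OF category_prod[OF category category_sset_cat]])
    fix p assume "p \<in> obj (prod_cat S (sset_cat U))"
    then obtain X K where p: "p = (X, K)" "X \<in> obj S" "is_sset U K" by auto
    then show "(case p of (X, K) \<Rightarrow> ten X K) \<in> obj S" by (simp add: ten_obj)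
    show "(THE t. induced p p (idt (prod_cat S (sset_cat U)) p) t) = idt S (case p of (X, K) \<Rightarrow> ten X K)"
    proof (rule the_eq)
      show "is_arrow (prod_cat S (sset_cat U)) p p (idt (prod_cat S (sset_cat U)) p)"
        using p arrow_idt[OF category] sset_id_hom by simp
      show "induced p p (idt (prod_cat S (sset_cat U)) p) (idt S (case p of (X, K) \<Rightarrow> ten X K))"
        using p induced_idt by simp
    qed
  next
    fix p q w assume w: "is_arrow (prod_cat S (sset_cat U)) p q w"
    obtain X K Y L f u where p: "p = (X, K)" "q = (Y, L)" "w = (f, u)" by (metis surj_pair)
    show "(THE t. induced p q w t) \<in> hom S (case p of (X, K) \<Rightarrow> ten X K) (case q of (X, K) \<Rightarrow> ten X K)"
      using w inducedD(1)[OF T[of X Y f K L u]] unfolding p by (simp add: is_arrow_def)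
  next
    fix p q r w w' assume w: "is_arrow (prod_cat S (sset_cat U)) p q w"
      and w': "is_arrow (prod_cat S (sset_cat U)) q r w'"
    obtain X K Y L f u where p: "p = (X, K)" "q = (Y, L)" "w = (f, u)" by (metis surj_pair)
    obtain Z M g v where r: "r = (Z, M)" "w' = (g, v)" by (metis surj_pair)
    show "(THE t. induced p r (cmp (prod_cat S (sset_cat U)) p q r w' w) t) =
        cmp S (case p of (X, K) \<Rightarrow> ten X K) (case q of (X, K) \<Rightarrow> ten X K) (case r of (X, K) \<Rightarrow> ten X K)
          (THE t. induced q r w' t) (THE t. induced p q w t)"
    proof (rule the_eq)
      show "is_arrow (prod_cat S (sset_cat U)) p r (cmp (prod_cat S (sset_cat U)) p q r w' w)"
        by (rule arrow_cmp[OF category_prod[OF category category_sset_cat] w w'])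
      show "induced p r (cmp (prod_cat S (sset_cat U)) p q r w' w)
        (cmp S (case p of (X, K) \<Rightarrow> ten X K) (case q of (X, K) \<Rightarrow> ten X K) (case r of (X, K) \<Rightarrow> ten X K)
          (THE t. induced q r w' t) (THE t. induced p q w t))"
        using w w' induced_cmp[of X Y f Z g K L M u v, OF _ _ _ _ _ _ _ T T] unfolding p r by simp
    qed
  qed
  then have "is_tensor_functor U S c T"
    unfolding is_tensor_functor_def
  proof (intro conjI ballI allI impI)
    fix X K assume "X \<in> obj S" "K \<in> obj (sset_cat U)"
    then show "fobj T (X, K) = ten X K" by (simp add: T_def)
  next
    fix X K L u assume X: "X \<in> obj S" and u: "is_arrow (sset_cat U) K L u"
    then show "sset_comp K (Map_post S X (ten X K) (ten X L) (farr T (X, K) (X, L) (idt S X, u))) (\<alpha> X K) =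
        sset_comp K (\<alpha> X L) u"
      using inducedD(2)[OF T[of X X "idt S X" K L u]] arrow_idt[OF category X]
        sset_hom_app[of u K L]
      by (intro sset_comp_eqI) (simp add: T_def Map_pre_idt ten_obj \<alpha>_in)
  next
    fix K X Y f assume K: "K \<in> obj (sset_cat U)" and f: "is_arrow S X Y f"
    then show "sset_comp K (Map_post S X (ten X K) (ten Y K) (farr T (X, K) (Y, K) (f, sset_id K))) (\<alpha> X K) =
        sset_comp K (Map_pre S X Y (ten Y K) f) (\<alpha> Y K)"
      using inducedD(2)[OF T[of X Y f K K "sset_id K"]] sset_id_hom[of U K]
      by (intro sset_comp_eqI) (simp add: T_def)
  qed
  then show "\<exists>T. is_tensor_functor U S c T" ..
next
  fix T T' assume T: "is_tensor_functor U S c T" and T': "is_tensor_functor U S c T'"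
  show "T = T'"
  proof (rule functor_eqI)
    show "is_functor (prod_cat S (sset_cat U)) S T" "is_functor (prod_cat S (sset_cat U)) S T'"
      using T T' by (simp_all add: is_tensor_functor_def)
    show "fobj T p = fobj T' p" if "p \<in> obj (prod_cat S (sset_cat U))" for p
      using T T' that by (auto simp: is_tensor_functor_def)
    fix p q w assume w: "is_arrow (prod_cat S (sset_cat U)) p q w"
    obtain X K Y L f u where p: "p = (X, K)" "q = (Y, L)" "w = (f, u)" by (metis surj_pair)
    show "farr T p q w = farr T' p q w"
    proof -
      have "induced p q w (farr T p q w)" "induced p q w (farr T' p q w)"
        using tensor_functor_induced[OF T] tensor_functor_induced[OF T'] w unfolding p by simp_all
      with induced_ex1[OF w] show ?thesis by blast
    qed
  qed
qed

lemma tensor_functor: "is_tensor_functor U S c (tensor U S c)"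
  unfolding tensor_def by (rule theI'[OF tensor_functor_ex1])

lemma is_functor_tensor: "is_functor (prod_cat S (sset_cat U)) S (tensor U S c)"
  using tensor_functor by (simp add: is_tensor_functor_def)

lemma fobj_tensor: "X \<in> obj S \<Longrightarrow> is_sset U K \<Longrightarrow> fobj (tensor U S c) (X, K) = ten X K"
  using tensor_functor by (simp add: is_tensor_functor_def)

lemmas tensor_induced = tensor_functor_induced[OF tensor_functor]

section \<open>Naturality of \<phi> in each variable\<close>

lemma Map_pre_in:
  "is_arrow S X Y f \<Longrightarrow> Z \<in> obj S \<Longrightarrow> x \<in> fobj (Map S Y Z) n \<Longrightarrow> Map_pre S X Y Z f n x \<in> fobj (Map S X Z) n"
  by (rule sset_hom_app[OF Map_pre_hom])

lemma Map_post_in: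
  "X \<in> obj S \<Longrightarrow> is_arrow S Y Z g \<Longrightarrow> x \<in> fobj (Map S X Y) n \<Longrightarrow> Map_post S X Y Z g n x \<in> fobj (Map S X Z) n"
  by (rule sset_hom_app[OF Map_post_hom])

lemma \<phi>_in:
  "X \<in> obj S \<Longrightarrow> is_sset U K \<Longrightarrow> Y \<in> obj S \<Longrightarrow> h \<in> fobj (Map S (ten X K) Y) n \<Longrightarrow>
   cyl_iso (c X K) Y n h \<in> sset_hom (sset_prod K (std_simplex n)) (Map S X Y)"
  using cylinder_iso_in[OF cyl] .

lemma \<phi>_app:
  "X \<in> obj S \<Longrightarrow> is_sset U K \<Longrightarrow> Y \<in> obj S \<Longrightarrow> h \<in> fobj (Map S (ten X K) Y) n \<Longrightarrow> k \<in> fobj K m \<Longrightarrow>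
   \<theta> \<in> hom simplex_cat m n \<Longrightarrow>
   cyl_iso (c X K) Y n h m (k, \<theta>) =
     scmp S X (ten X K) Y m (\<alpha> X K m k, farr (Map S (ten X K) Y) n m \<theta> h)"
  using cylinder_iso_app[OF _ cyl] .

text \<open>At (k, \<theta>), \<open>scmp_pre_right\<close> moves the action of t from the factor
  \<theta>^*h onto \<alpha>(k), where the equation for t replaces it by \<alpha>(u(k)).\<close>

lemma \<phi>_natural_K:
  assumes X: "X \<in> obj S" and Y: "Y \<in> obj S" and K: "is_sset U K" and L: "is_sset U L"
    and u: "u \<in> sset_hom K L" and t: "induced (X, K) (X, L) (idt S X, u) t"
  shows "sset_comp (Map S (ten X L) Y) (cyl_iso (c X K) Y) (Map_pre S (ten X K) (ten X L) Y t) =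
    sset_comp (Map S (ten X L) Y) (sset_ihom_pre K L (Map S X Y) u) (cyl_iso (c X L) Y)"
proof (intro sset_comp_eqI)
  fix n h assume h: "h \<in> fobj (Map S (ten X L) Y) n"
  note ta = inducedD(1)[OF t] and \<phi>h = \<phi>_in[OF X L Y h]
  note ph = Map_pre_in[OF ta Y h]
  show "cyl_iso (c X K) Y n (Map_pre S (ten X K) (ten X L) Y t n h) =
      sset_ihom_pre K L (Map S X Y) u n (cyl_iso (c X L) Y n h)"
  proof (rule ihom_eqI[OF \<phi>_in[OF X K Y ph] ihom_pre_in[OF K u \<phi>h]])
    fix m k \<theta> assume k: "k \<in> fobj K m" and \<theta>: "\<theta> \<in> hom simplex_cat m n"
    note uk = sset_hom_app[OF u k]
    let ?h = "farr (Map S (ten X L) Y) n m \<theta> h"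
    have h': "?h \<in> fobj (Map S (ten X L) Y) m"
      using sset_farr[OF sset_Map[OF ten_obj[OF X L] Y] \<theta> h] .
    have "cyl_iso (c X K) Y n (Map_pre S (ten X K) (ten X L) Y t n h) m (k, \<theta>) =
        scmp S X (ten X K) Y m (\<alpha> X K m k, Map_pre S (ten X K) (ten X L) Y t m ?h)"
      using \<phi>_app[OF X K Y ph k \<theta>] sset_hom_nat[OF Map_pre_hom[OF ta Y] \<theta> h] by simp
    also have "\<dots> = scmp S X (ten X L) Y m (\<alpha> X L m (u m k), ?h)"
      using scmp_pre_right[OF X ta Y \<alpha>_in[OF X K k] h'] inducedD(2)[OF t k]
        Map_pre_idt[OF X ten_obj[OF X L] \<alpha>_in[OF X L uk]] by simp
    also have "\<dots> = sset_ihom_pre K L (Map S X Y) u n (cyl_iso (c X L) Y n h) m (k, \<theta>)"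
      using \<phi>_app[OF X L Y h uk \<theta>] ihom_pre_app[OF \<phi>h k \<theta>] by simp
    finally show "cyl_iso (c X K) Y n (Map_pre S (ten X K) (ten X L) Y t n h) m (k, \<theta>) =
        sset_ihom_pre K L (Map S X Y) u n (cyl_iso (c X L) Y n h) m (k, \<theta>)" .
  qed
qed

text \<open>As for K, except that moving t onto \<alpha> leaves S(f,-) behind, which
  \<open>scmp_pre_left\<close> then pulls out of the composite.\<close>

lemma \<phi>_natural_X:
  assumes f: "is_arrow S X X' f" and Y: "Y \<in> obj S" and K: "is_sset U K"
    and t: "induced (X, K) (X', K) (f, sset_id K) t"
  shows "sset_comp (Map S (ten X' K) Y) (cyl_iso (c X K) Y) (Map_pre S (ten X K) (ten X' K) Y t) =
    sset_comp (Map S (ten X' K) Y) (sset_ihom_post K (Map S X' Y) (Map_pre S X X' Y f)) (cyl_iso (c X' K) Y)"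
proof (intro sset_comp_eqI)
  note ob = arrow_obj[OF f]
  fix n h assume h: "h \<in> fobj (Map S (ten X' K) Y) n"
  note ta = inducedD(1)[OF t] and \<phi>h = \<phi>_in[OF ob(2) K Y h]
  note ph = Map_pre_in[OF ta Y h]
  show "cyl_iso (c X K) Y n (Map_pre S (ten X K) (ten X' K) Y t n h) =
      sset_ihom_post K (Map S X' Y) (Map_pre S X X' Y f) n (cyl_iso (c X' K) Y n h)"
  proof (rule ihom_eqI[OF \<phi>_in[OF ob(1) K Y ph] ihom_post_in[OF K Map_pre_hom[OF f Y] \<phi>h]])
    fix m k \<theta> assume k: "k \<in> fobj K m" and \<theta>: "\<theta> \<in> hom simplex_cat m n"
    let ?h = "farr (Map S (ten X' K) Y) n m \<theta> h"
    have h': "?h \<in> fobj (Map S (ten X' K) Y) m"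
      using sset_farr[OF sset_Map[OF ten_obj[OF ob(2) K] Y] \<theta> h] .
    have "cyl_iso (c X K) Y n (Map_pre S (ten X K) (ten X' K) Y t n h) m (k, \<theta>) =
        scmp S X (ten X K) Y m (\<alpha> X K m k, Map_pre S (ten X K) (ten X' K) Y t m ?h)"
      using \<phi>_app[OF ob(1) K Y ph k \<theta>] sset_hom_nat[OF Map_pre_hom[OF ta Y] \<theta> h] by simp
    also have "\<dots> = scmp S X (ten X' K) Y m (Map_pre S X X' (ten X' K) f m (\<alpha> X' K m k), ?h)"
      using scmp_pre_right[OF ob(1) ta Y \<alpha>_in[OF ob(1) K k] h'] inducedD(2)[OF t k] k by simp
    also have "\<dots> = Map_pre S X X' Y f m (scmp S X' (ten X' K) Y m (\<alpha> X' K m k, ?h))"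
      by (rule scmp_pre_left[OF f ten_obj[OF ob(2) K] Y \<alpha>_in[OF ob(2) K k] h'])
    also have "\<dots> = sset_ihom_post K (Map S X' Y) (Map_pre S X X' Y f) n (cyl_iso (c X' K) Y n h) m (k, \<theta>)"
      using \<phi>_app[OF ob(2) K Y h k \<theta>] ihom_post_app[OF \<phi>h k \<theta>, of "Map_pre S X X' Y f"] by simp
    finally show "cyl_iso (c X K) Y n (Map_pre S (ten X K) (ten X' K) Y t n h) m (k, \<theta>) =
        sset_ihom_post K (Map S X' Y) (Map_pre S X X' Y f) n (cyl_iso (c X' K) Y n h) m (k, \<theta>)" .
  qed
qed

text \<open>No morphism between cylinders is involved: g acts at the far end of the composite and is
  pulled out by associativity.\<close>

lemma \<phi>_natural_Y:
  assumes X: "X \<in> obj S" and g: "is_arrow S Y Y' g" and K: "is_sset U K"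
  shows "sset_comp (Map S (ten X K) Y) (cyl_iso (c X K) Y') (Map_post S (ten X K) Y Y' g) =
    sset_comp (Map S (ten X K) Y) (sset_ihom_post K (Map S X Y) (Map_post S X Y Y' g)) (cyl_iso (c X K) Y)"
proof (intro sset_comp_eqI)
  note ob = arrow_obj[OF g] and XK = ten_obj[OF X K]
  fix n h assume h: "h \<in> fobj (Map S (ten X K) Y) n"
  note \<phi>h = \<phi>_in[OF X K ob(1) h] and ph = Map_post_in[OF XK g h]
  show "cyl_iso (c X K) Y' n (Map_post S (ten X K) Y Y' g n h) =
      sset_ihom_post K (Map S X Y) (Map_post S X Y Y' g) n (cyl_iso (c X K) Y n h)"
  proof (rule ihom_eqI[OF \<phi>_in[OF X K ob(2) ph] ihom_post_in[OF K Map_post_hom[OF X g] \<phi>h]])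
    fix m k \<theta> assume k: "k \<in> fobj K m" and \<theta>: "\<theta> \<in> hom simplex_cat m n"
    let ?h = "farr (Map S (ten X K) Y) n m \<theta> h"
    have h': "?h \<in> fobj (Map S (ten X K) Y) m"
      using sset_farr[OF sset_Map[OF XK ob(1)] \<theta> h] .
    have "cyl_iso (c X K) Y' n (Map_post S (ten X K) Y Y' g n h) m (k, \<theta>) =
        scmp S X (ten X K) Y' m (\<alpha> X K m k, Map_post S (ten X K) Y Y' g m ?h)"
      using \<phi>_app[OF X K ob(2) ph k \<theta>] sset_hom_nat[OF Map_post_hom[OF XK g] \<theta> h] by simp
    also have "\<dots> = Map_post S X Y Y' g m (scmp S X (ten X K) Y m (\<alpha> X K m k, ?h))"
      by (rule scmp_post_right[OF X XK g \<alpha>_in[OF X K k] h'])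
    also have "\<dots> = sset_ihom_post K (Map S X Y) (Map_post S X Y Y' g) n (cyl_iso (c X K) Y n h) m (k, \<theta>)"
      using \<phi>_app[OF X K ob(1) h k \<theta>] ihom_post_app[OF \<phi>h k \<theta>, of "Map_post S X Y Y' g"] by simp
    finally show "cyl_iso (c X K) Y' n (Map_post S (ten X K) Y Y' g n h) m (k, \<theta>) =
        sset_ihom_post K (Map S X Y) (Map_post S X Y Y' g) n (cyl_iso (c X K) Y n h) m (k, \<theta>)" .
  qed
qed

theorem cyl_iso_natural: "cyl_iso_natural U S c"
  unfolding cyl_iso_natural_def Let_def
  using \<phi>_natural_K \<phi>_natural_X \<phi>_natural_Y
  by (simp add: tensor_induced arrow_idt[OF category] sset_id_hom)

section \<open>Transposes and the first adjunction\<close>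

definition tensor_transpose :: "'o \<Rightarrow> 'a sset \<Rightarrow> 'o \<Rightarrow> 'm \<Rightarrow> ('a, 'a) smap" where
  "tensor_transpose X K Y g = sset_comp K (Map_post S X (ten X K) Y g) (\<alpha> X K)"

lemma tensor_transpose_bij:
  "X \<in> obj S \<Longrightarrow> is_sset U K \<Longrightarrow> Y \<in> obj S \<Longrightarrow>
   bij_betw (tensor_transpose X K Y) (hom S (ten X K) Y) (sset_hom K (Map S X Y))"
  unfolding tensor_transpose_def using cylinder_transpose_bij[OF _ _ cyl] by blast

text \<open>Natural in all three variables at once, to serve both adjunctions of the tensor: the
  first uses it with f an identity, the third with u an identity, and the third also uses its dual
  for paths.\<close>

lemma tensor_transpose_natural:
  assumes f: "is_arrow S X' X f" and g: "is_arrow S Y Y' g"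
    and K: "is_sset U K" and K': "is_sset U K'" and u: "u \<in> sset_hom K' K"
    and t: "induced (X', K') (X, K) (f, u) t" and h: "h \<in> hom S (ten X K) Y" and k: "k \<in> fobj K' n"
  shows "tensor_transpose X' K' Y' (cmp S (ten X' K') Y Y' g (cmp S (ten X' K') (ten X K) Y h t)) n k =
    Map_post S X' Y Y' g n (Map_pre S X' X Y f n (tensor_transpose X K Y h n (u n k)))"
proof -
  note ob = arrow_obj[OF f] arrow_obj[OF g] and ta = inducedD(1)[OF t] and uk = sset_hom_app[OF u k]
  have h: "is_arrow S (ten X K) Y h"
    using h ob K by (simp add: is_arrow_def ten_obj)
  note ht = arrow_cmp[OF category ta h] and \<alpha>k = \<alpha>_in[OF ob(1) K' k] and \<alpha>uk = \<alpha>_in[OF ob(2) K uk]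
  have "Map_post S X' (ten X' K') Y (cmp S (ten X' K') (ten X K) Y h t) n (\<alpha> X' K' n k) =
      Map_pre S X' X Y f n (Map_post S X (ten X K) Y h n (\<alpha> X K n (u n k)))"
    using Map_post_cmp[OF ob(1) ta h \<alpha>k] inducedD(2)[OF t k] Map_post_pre[OF f h \<alpha>uk] by simp
  then show ?thesis
    using Map_post_cmp[OF ob(1) ht g \<alpha>k] k uk by (simp add: tensor_transpose_def)
qed

theorem tensor_left_adjoint_Map:
  assumes X: "X \<in> obj S"
  shows "left_adjoint (sset_cat U) S
    (fix_fst S (sset_cat U) (tensor U S c) X) (fix_fst (op_cat S) S (enr S) X)"
    (is "left_adjoint _ _ ?F ?G")
proof -
  have F: "fobj ?F K = ten X K" if "is_sset U K" for K
    using that X by (simp add: fix_fst_def fobj_tensor)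
  have Farr: "induced (X, K) (X, L) (idt S X, u) (farr ?F K L u)"
    if "is_sset U K" "is_sset U L" "u \<in> sset_hom K L" for K L u
    using that tensor_induced[OF arrow_idt[OF category X]] by (simp add: fix_fst_def)
  have G: "fobj ?G Y = Map S X Y" if "Y \<in> obj S" for Y
    using that by (simp add: fix_fst_def Map_def)
  have Garr: "farr ?G Y Y' g = Map_post S X Y Y' g" if "is_arrow S Y Y' g" for Y Y' g
    using that by (simp add: fix_fst_def Map_post_def)
  have "is_functor (sset_cat U) S ?F"
    by (rule is_functor_fix_fst[OF is_functor_tensor category category_sset_cat X])
  moreover have "is_functor S (sset_cat U) ?G"
    using is_functor_fix_fst[OF functor_enr category_op[OF category] category] X by simp
  moreover have "bij_betw (tensor_transpose X K Y) (hom S (fobj ?F K) Y) (hom (sset_cat U) K (fobj ?G Y))"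
    if "K \<in> obj (sset_cat U)" "Y \<in> obj S" for K Y
    using that tensor_transpose_bij[OF X] by (simp add: F G)
  moreover have "tensor_transpose X K' Y' (cmp S (fobj ?F K') Y Y' g
      (cmp S (fobj ?F K') (fobj ?F K) Y h (farr ?F K' K u))) =
    cmp (sset_cat U) K' (fobj ?G Y) (fobj ?G Y') (farr ?G Y Y' g)
      (cmp (sset_cat U) K' K (fobj ?G Y) (tensor_transpose X K Y h) u)"
    if u: "is_arrow (sset_cat U) K' K u" and g: "is_arrow S Y Y' g" and h: "h \<in> hom S (fobj ?F K) Y"
    for K' K u Y Y' g h
  proof -
    have K: "is_sset U K'" "is_sset U K" "u \<in> sset_hom K' K" using u by simp_all
    note ob = arrow_obj[OF g]
    have h': "h \<in> hom S (ten X K) Y" using h K F by simp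
    note v = bij_betw_apply[OF tensor_transpose_bij[OF X K(2) ob(1)] h']
    have "tensor_transpose X K' Y' (cmp S (ten X K') Y Y' g (cmp S (ten X K') (ten X K) Y h (farr ?F K' K u))) n k =
        Map_post S X Y Y' g n (tensor_transpose X K Y h n (u n k))" if k: "k \<in> fobj K' n" for n k
      using tensor_transpose_natural[OF arrow_idt[OF category X] g K(2,1,3) Farr[OF K] h' k]
        Map_pre_idt[OF X ob(1) sset_hom_app[OF v sset_hom_app[OF K(3) k]]] by simp
    then have "tensor_transpose X K' Y' (cmp S (ten X K') Y Y' g (cmp S (ten X K') (ten X K) Y h (farr ?F K' K u))) =
        sset_comp K' (Map_post S X Y Y' g) (sset_comp K' (tensor_transpose X K Y h) u)"
      \<comment> \<open>Only the transpose at \<open>K'\<close> is unfolded, so that both sides are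
        composites restricted to the simplices of \<open>K'\<close>.\<close>
      unfolding tensor_transpose_def[of X K'] by (intro sset_comp_eqI) simp
    then show ?thesis
      using K ob by (simp add: F G Garr[OF g])
  qed
  ultimately show ?thesis
    unfolding left_adjoint_def by blast
qed

end


section \<open>The opposite simplicial category\<close>

definition op_simp_cat :: "('o, 'm, 'a) simp_cat \<Rightarrow> ('o, 'm, 'a) simp_cat" where
  "op_simp_cat S = \<lparr>obj = obj S, hom = (\<lambda>X Y. hom S Y X), idt = idt S,
     cmp = (\<lambda>X Y Z g f. cmp S Z Y X f g),
     enr = \<lparr>fobj = (\<lambda>(X, Y). fobj (enr S) (Y, X)),
       farr = (\<lambda>(X, Y) (X', Y') (f, g). farr (enr S) (Y, X) (Y', X') (g, f))\<rparr>,
     scmp = (\<lambda>X Y Z n. \<lambda>z \<in> fobj (Map S Y X) n \<times> fobj (Map S Z Y) n. scmp S Z Y X n (snd z, fst z)),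
     tld = (\<lambda>X Y. tld S Y X)\<rparr>"

lemma op_simp_cat_simps [simp]:
  "obj (op_simp_cat S) = obj S" "hom (op_simp_cat S) X Y = hom S Y X" "idt (op_simp_cat S) = idt S"
  "cmp (op_simp_cat S) X Y Z g f = cmp S Z Y X f g"
  "fobj (enr (op_simp_cat S)) (X, Y) = fobj (enr S) (Y, X)"
  "farr (enr (op_simp_cat S)) (X, Y) (X', Y') (f, g) = farr (enr S) (Y, X) (Y', X') (g, f)"
  "tld (op_simp_cat S) X Y = tld S Y X"
  by (simp_all add: op_simp_cat_def)

lemma is_arrow_op_simp_cat [simp]: "is_arrow (op_simp_cat S) X Y f \<longleftrightarrow> is_arrow S Y X f"
  by (auto simp: is_arrow_def)

lemma Map_op [simp]: "Map (op_simp_cat S) X Y = Map S Y X"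
  by (simp add: Map_def)

lemma Map_post_op [simp]: "Map_post (op_simp_cat S) X Y Z g = Map_pre S Z Y X g"
  by (simp add: Map_post_def Map_pre_def)

lemma Map_pre_op [simp]: "Map_pre (op_simp_cat S) X Y Z f = Map_post S Z Y X f"
  by (simp add: Map_post_def Map_pre_def)

lemma degen_op [simp]: "degen (op_simp_cat S) X Y n f = degen S Y X n f"
  by (simp add: degen_def)

lemma scmp_op [simp]:
  "f \<in> fobj (Map S Y X) n \<Longrightarrow> g \<in> fobj (Map S Z Y) n \<Longrightarrow>
   scmp (op_simp_cat S) X Y Z n (f, g) = scmp S Z Y X n (g, f)"
  by (simp add: op_simp_cat_def)

text \<open>These three predicates only inspect the underlying category, so the enrichment carried
  by \<open>op_simp_cat S\<close> may be forgotten.\<close>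

lemma is_functor_into_op_simp_cat: "is_functor C (op_simp_cat S) F \<longleftrightarrow> is_functor C (op_cat S) F"
  by (simp add: is_functor_def)

lemma is_functor_from_op_simp_cat: "is_functor (op_simp_cat S) D F \<longleftrightarrow> is_functor (op_cat S) D F"
  by (simp add: is_functor_def)

lemma left_adjoint_op_simp_cat: "left_adjoint C (op_simp_cat S) F G \<longleftrightarrow> left_adjoint C (op_cat S) F G"
  by (simp add: left_adjoint_def is_functor_into_op_simp_cat is_functor_from_op_simp_cat)

text \<open>The source of a tensor functor for the opposite category is thereby the opposite of the
  source of a cotensor functor, so that \<open>op_functor\<close> passes between the two
  kinds.\<close>

lemma prod_cat_op_simp_cat: "prod_cat (op_simp_cat S) D = op_cat (prod_cat S (op_cat D))"
  by (simp add: prod_cat_def op_cat_def op_simp_cat_def fun_eq_iff)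

text \<open>The axioms are self-dual: (S4) is read backwards, and the two equations of (S5) change
  places.\<close>

lemma (in simplicial_category) simplicial_category_op: "simplicial_category U (op_simp_cat S)"
proof
  have cat: "is_category (op_simp_cat S)"
    using category_op[OF category] by (simp add: is_category_def)
  have enr: "is_functor (prod_cat (op_cat (op_simp_cat S)) (op_simp_cat S)) (sset_cat U) (enr (op_simp_cat S))"
    unfolding is_functor_def Ball_def split_paired_All
  proof (intro conjI allI impI ballI)
    fix X Y assume "(X, Y) \<in> obj (prod_cat (op_cat (op_simp_cat S)) (op_simp_cat S))"
    then show "fobj (enr (op_simp_cat S)) (X, Y) \<in> obj (sset_cat U)"
      "farr (enr (op_simp_cat S)) (X, Y) (X, Y) (idt (prod_cat (op_cat (op_simp_cat S)) (op_simp_cat S)) (X, Y)) =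
        idt (sset_cat U) (fobj (enr (op_simp_cat S)) (X, Y))"
      using functor_obj[OF functor_enr, of "(Y, X)"] functor_idt[OF functor_enr, of "(Y, X)"] by simp_all
  next
    fix X Y X' Y' f g
    assume "is_arrow (prod_cat (op_cat (op_simp_cat S)) (op_simp_cat S)) (X, Y) (X', Y') (f, g)"
    then show "farr (enr (op_simp_cat S)) (X, Y) (X', Y') (f, g) \<in>
        hom (sset_cat U) (fobj (enr (op_simp_cat S)) (X, Y)) (fobj (enr (op_simp_cat S)) (X', Y'))"
      using functor_hom[OF functor_enr, of "(Y, X)" "(Y', X')" "(g, f)"] by simp
  next
    fix X Y X' Y' X'' Y'' f g f' g'
    assume "is_arrow (prod_cat (op_cat (op_simp_cat S)) (op_simp_cat S)) (X, Y) (X', Y') (f, g) \<and>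
      is_arrow (prod_cat (op_cat (op_simp_cat S)) (op_simp_cat S)) (X', Y') (X'', Y'') (f', g')"
    then show "farr (enr (op_simp_cat S)) (X, Y) (X'', Y'')
        (cmp (prod_cat (op_cat (op_simp_cat S)) (op_simp_cat S)) (X, Y) (X', Y') (X'', Y'') (f', g') (f, g)) =
      cmp (sset_cat U) (fobj (enr (op_simp_cat S)) (X, Y)) (fobj (enr (op_simp_cat S)) (X', Y'))
        (fobj (enr (op_simp_cat S)) (X'', Y'')) (farr (enr (op_simp_cat S)) (X', Y') (X'', Y'') (f', g'))
        (farr (enr (op_simp_cat S)) (X, Y) (X', Y') (f, g))"
      using functor_cmp[OF functor_enr, of "(Y, X)" "(Y', X')" "(g, f)" "(Y'', X'')" "(g', f')"] by simp
  next
    fix X Y assume "(X, Y) \<notin> obj (prod_cat (op_cat (op_simp_cat S)) (op_simp_cat S))"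
    then show "fobj (enr (op_simp_cat S)) (X, Y) = undefined"
      using functor_enr by (auto simp: is_functor_def)
  next
    fix X Y X' Y' f g
    assume "\<not> is_arrow (prod_cat (op_cat (op_simp_cat S)) (op_simp_cat S)) (X, Y) (X', Y') (f, g)"
    then have "\<not> is_arrow (prod_cat (op_cat S) S) (Y, X) (Y', X') (g, f)" by auto
    then show "farr (enr (op_simp_cat S)) (X, Y) (X', Y') (f, g) = undefined"
      using functor_enr unfolding is_functor_def by (metis op_simp_cat_simps(6))
  qed
  have scmp: "scmp (op_simp_cat S) X Y Z \<in>
      sset_hom (sset_prod (Map (op_simp_cat S) X Y) (Map (op_simp_cat S) Y Z)) (Map (op_simp_cat S) X Z)"
    if "X \<in> obj S" "Y \<in> obj S" "Z \<in> obj S" for X Y Z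
  proof -
    have "scmp S Z Y X m (farr (Map S Z Y) n m \<theta> g, farr (Map S Y X) n m \<theta> f) =
        farr (Map S Z X) n m \<theta> (scmp S Z Y X n (g, f))"
      if "\<theta> \<in> hom simplex_cat m n" "f \<in> fobj (Map S Y X) n" "g \<in> fobj (Map S Z Y) n" for m n \<theta> f g
      using sset_hom_nat[OF scmp_hom, of Z Y X \<theta> m n "(g, f)"] that \<open>X \<in> obj S\<close> \<open>Y \<in> obj S\<close> \<open>Z \<in> obj S\<close>
      by simp
    then show ?thesis
      using that unfolding sset_hom_def
      by (auto simp: sset_farr[OF sset_Map] scmp_in) (auto simp: op_simp_cat_def scmp_in split: if_splits)
  qed
  have tld_nat: "tld S X' Y' (cmp S X' Y Y' g (cmp S X' X Y h f)) =
      farr (enr S) (X, Y) (X', Y') (f, g) 0 (tld S X Y h)"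
    if "is_arrow S X' X f" "is_arrow S Y Y' g" "h \<in> hom S X Y" for X' X f Y Y' g h
    using simplicial that by (simp add: is_simplicial_category_def)
  \<comment> \<open>Reversing arrows turns g(hf) into the other bracketing of the threefold
    composite, hence the appeal to associativity.\<close>
  have "tld S Y' X' (cmp S Y' Y X' (cmp S Y X X' f h) g) =
      farr (enr S) (Y, X) (Y', X') (g, f) 0 (tld S Y X h)"
    if "is_arrow S X X' f" "is_arrow S Y' Y g" "h \<in> hom S Y X" for X' X f Y Y' g h
    using tld_nat[OF that(2,1,3)] category_assoc[OF category that(2) _ that(1), of h] that
    by (simp add: is_arrow_def)
  with cat enr scmp show "is_simplicial_category U (op_simp_cat S)"
    unfolding is_simplicial_category_def
    by (simp add: tld_bij scmp_in scmp_assoc Map_post_eq Map_pre_eq degen_in is_arrow_def)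
qed

definition path_cylinder :: "('o, 'a) pathobj \<Rightarrow> ('o, 'a) cylinder" where
  "path_cylinder p = \<lparr>cyl_obj = path_obj p, cyl_map = path_map p, cyl_iso = path_iso p\<rparr>"

lemma path_cylinder_simps [simp]:
  "cyl_obj (path_cylinder p) = path_obj p" "cyl_map (path_cylinder p) = path_map p"
  "cyl_iso (path_cylinder p) = path_iso p"
  by (simp_all add: path_cylinder_def)

text \<open>The pairing of the second projection with \<beta> after the first lists the factors in
  the order of composition in S. The opposite composition swaps them back, which leaves \<beta>
  \<times> id as for a cylinder.\<close>

lemma is_cylinder_path_cylinder:
  assumes p: "is_path S X K p"
  shows "is_cylinder (op_simp_cat S) X K (path_cylinder p)"
proof -
  let ?M = "\<lambda>Y. Map S Y (path_obj p)"
  have \<beta>: "path_map p \<in> sset_hom K (Map S (path_obj p) X)"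
    using p by (simp add: is_path_def Let_def)
  have "sset_comp (sset_prod K (?M Y)) (scmp S Y (path_obj p) X)
      (sset_pair (sset_prod K (?M Y)) (sset_pr2 K (?M Y))
        (sset_comp (sset_prod K (?M Y)) (path_map p) (sset_pr1 K (?M Y)))) =
    sset_comp (sset_prod K (?M Y)) (scmp (op_simp_cat S) X (path_obj p) Y)
      (sset_map_prod K (?M Y) (path_map p) (sset_id (?M Y)))" for Y
    by (rule sset_comp_eqI)
      (auto simp: sset_pair_def sset_pr1_def sset_pr2_def sset_map_prod_def sset_hom_app[OF \<beta>])
  with p show ?thesis
    by (simp add: is_path_def is_cylinder_def Let_def)
qed


section \<open>The cotensor functor\<close>

locale cotensored_category = simplicial_category U S
  for U :: "'a set set" and S :: "('o, 'm, 'a) simp_cat" +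
  fixes p :: "'o \<Rightarrow> 'a sset \<Rightarrow> ('o, 'a) pathobj"
  assumes path_choice: "path_choice U S p"
begin

text \<open>Makes every fact about tensors available under the prefix \<open>dual\<close>, with X^K
  in the role of X \<otimes> K.\<close>

sublocale dual: tensored_category U "op_simp_cat S" "\<lambda>X K. path_cylinder (p X K)"
proof (intro tensored_category.intro tensored_category_axioms.intro)
  show "simplicial_category U (op_simp_cat S)"
    by (rule simplicial_category_op)
  show "cylinder_choice U (op_simp_cat S) (\<lambda>X K. path_cylinder (p X K))"
    using path_choice by (simp add: cylinder_choice_def path_choice_def is_cylinder_path_cylinder)
qed

abbreviation dual_tensor :: "('o, 'm, 'a) sset_action" where
  "dual_tensor \<equiv> tensor U (op_simp_cat S) (\<lambda>X K. path_cylinder (p X K))"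

text \<open>The equations for \<alpha> become those for \<beta> once \<open>Map_post\<close> and
  \<open>Map_pre\<close> are exchanged. Since \<open>op_functor\<close> is an involution, unique
  existence carries over to cotensor functors.\<close>

lemma is_cotensor_functor_dual:
  "is_cotensor_functor U S p T \<longleftrightarrow>
   is_tensor_functor U (op_simp_cat S) (\<lambda>X K. path_cylinder (p X K)) (op_functor T)"
proof -
  have "is_functor (prod_cat (op_simp_cat S) (sset_cat U)) (op_simp_cat S) (op_functor T) \<longleftrightarrow>
      is_functor (prod_cat S (op_cat (sset_cat U))) S T"
    by (simp only: is_functor_into_op_simp_cat prod_cat_op_simp_cat is_functor_op_functor)
  then show ?thesis
    unfolding is_cotensor_functor_def is_tensor_functor_def by (simp; blast)
qed

lemma cotensor_eq: "cotensor U S p = op_functor dual_tensor"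
  unfolding cotensor_def
proof (rule the_equality)
  show "is_cotensor_functor U S p (op_functor dual_tensor)"
    by (simp add: is_cotensor_functor_dual dual.tensor_functor)
  fix T assume "is_cotensor_functor U S p T"
  then have "op_functor T = dual_tensor"
    using dual.tensor_functor_ex1 dual.tensor_functor unfolding is_cotensor_functor_dual by blast
  then show "T = op_functor dual_tensor"
    by (metis op_functor_op_functor)
qed

theorem path_iso_natural: "path_iso_natural U S p"
  using dual.cyl_iso_natural unfolding cyl_iso_natural_def path_iso_natural_def Let_def cotensor_eq
  by (simp; blast)

theorem cotensor_left_adjoint_Map:
  assumes X: "X \<in> obj S"
  shows "left_adjoint (sset_cat U) (op_cat S)
    (op_functor (fix_fst S (op_cat (sset_cat U)) (cotensor U S p) X)) (fix_snd (op_cat S) S (enr S) X)"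
proof -
  \<comment> \<open>As records, both functors are the partial functors with X in the first place
    that belong to the opposite category, so its first adjunction applies.\<close>
  have "op_functor (fix_fst S (op_cat (sset_cat U)) (cotensor U S p) X) =
      fix_fst (op_simp_cat S) (sset_cat U) dual_tensor X"
    by (simp add: fix_fst_def mk_functor_def op_functor_def cotensor_eq fun_eq_iff)
  moreover have "fix_snd (op_cat S) S (enr S) X =
      fix_fst (op_cat (op_simp_cat S)) (op_simp_cat S) (enr (op_simp_cat S)) X"
    by (simp add: fix_fst_def fix_snd_def mk_functor_def fun_eq_iff)
  ultimately show ?thesis
    using dual.tensor_left_adjoint_Map[of X] X by (simp add: left_adjoint_op_simp_cat)
qed

lemma is_functor_cotensor: "is_functor (prod_cat S (op_cat (sset_cat U))) S (cotensor U S p)"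
  using dual.tensor_functor is_cotensor_functor_dual[of "cotensor U S p"]
  by (simp add: cotensor_eq is_cotensor_functor_def)

end

section \<open>The third adjunction, through transposes in maps from K to S(X,Y)\<close>

theorem tensor_left_adjoint_cotensor:
  assumes "tensored_category U S c" and "cotensored_category U S p" and K: "K \<in> obj (sset_cat U)"
  shows "left_adjoint S S
    (fix_snd S (sset_cat U) (tensor U S c) K) (fix_snd S (op_cat (sset_cat U)) (cotensor U S p) K)"
    (is "left_adjoint _ _ ?F ?G")
proof -
  interpret T: tensored_category U S c by fact
  interpret P: cotensored_category U S p by fact
  have K: "is_sset U K" using K by simp
  note id = sset_id_hom[OF K]
  have F: "fobj ?F X = cyl_obj (c X K)" if "X \<in> obj S" for X
    using that K by (simp add: fix_snd_def T.fobj_tensor)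
  have Farr: "T.induced (X', K) (X, K) (f, sset_id K) (farr ?F X' X f)" if "is_arrow S X' X f" for X' X f
    using T.tensor_induced[OF that K K id] that by (simp add: fix_snd_def)
  have G: "fobj ?G Y = path_obj (p Y K)" if "Y \<in> obj S" for Y
    using that K P.dual.fobj_tensor[of Y K] by (simp add: fix_snd_def P.cotensor_eq)
  have Garr: "P.dual.induced (Y', K) (Y, K) (g, sset_id K) (farr ?G Y Y' g)" if "is_arrow S Y Y' g" for Y Y' g
    using P.dual.tensor_induced[of Y' Y g K K "sset_id K"] that K id
    by (simp add: fix_snd_def P.cotensor_eq)
  let ?t = "\<lambda>X Y. T.tensor_transpose X K Y"
  let ?p = "\<lambda>X Y. P.dual.tensor_transpose Y K X"
  have t: "bij_betw (?t X Y) (hom S (fobj ?F X) Y) (sset_hom K (Map S X Y))"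
    and p: "bij_betw (?p X Y) (hom S X (fobj ?G Y)) (sset_hom K (Map S X Y))"
    if "X \<in> obj S" "Y \<in> obj S" for X Y
    using that K T.tensor_transpose_bij[of X K Y] P.dual.tensor_transpose_bij[of Y K X] by (simp_all add: F G)
  \<comment> \<open>Both hom-sets are in bijection with the simplicial maps from K to S(X,Y): h and
    its adjunct are the two morphisms with the same transpose there.\<close>
  define \<Phi> where "\<Phi> X Y = inv_into (hom S X (fobj ?G Y)) (?p X Y) \<circ> ?t X Y" for X Y
  have \<Phi>: "bij_betw (\<Phi> X Y) (hom S (fobj ?F X) Y) (hom S X (fobj ?G Y))"
    if "X \<in> obj S" "Y \<in> obj S" for X Y
    unfolding \<Phi>_def by (rule bij_betw_trans[OF t[OF that] bij_betw_inv_into[OF p[OF that]]])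
  have p\<Phi>: "?p X Y (\<Phi> X Y h) = ?t X Y h"
    if "X \<in> obj S" "Y \<in> obj S" "h \<in> hom S (fobj ?F X) Y" for X Y h
    using that bij_betw_inv_into_right[OF p[OF that(1,2)] bij_betw_apply[OF t[OF that(1,2)] that(3)]]
    by (simp add: \<Phi>_def)
  have isF: "is_functor S S ?F"
    by (rule is_functor_fix_snd[OF T.is_functor_tensor T.category category_sset_cat]) (simp add: K)
  have isG: "is_functor S S ?G"
    by (rule is_functor_fix_snd[OF P.is_functor_cotensor T.category category_op[OF category_sset_cat]])
      (simp add: K)
  have "\<Phi> X' Y' (cmp S (fobj ?F X') Y Y' g (cmp S (fobj ?F X') (fobj ?F X) Y h (farr ?F X' X f))) =
      cmp S X' (fobj ?G Y) (fobj ?G Y') (farr ?G Y Y' g) (cmp S X' X (fobj ?G Y) (\<Phi> X Y h) f)"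
    (is "\<Phi> X' Y' ?a = ?b")
    if f: "is_arrow S X' X f" and g: "is_arrow S Y Y' g" and h: "h \<in> hom S (fobj ?F X) Y"
    for X' X f Y Y' g h
  proof -
    note ob = T.arrow_obj[OF f] T.arrow_obj[OF g]
    note Ff = functor_arrow[OF isF f] and Gg = functor_arrow[OF isG g]
    have h': "is_arrow S (fobj ?F X) Y h" using h ob F K T.ten_obj by (simp add: is_arrow_def)
    note \<Phi>h = bij_betw_apply[OF \<Phi>[OF ob(2,3)] h]
    have \<Phi>h': "is_arrow S X (fobj ?G Y) (\<Phi> X Y h)"
      using \<Phi>h ob Gg by (simp add: is_arrow_def)
    have a: "?a \<in> hom S (fobj ?F X') Y'"
      by (rule category_cmp[OF T.category arrow_cmp[OF T.category Ff h'] g])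
    have b: "?b \<in> hom S X' (fobj ?G Y')"
      by (rule category_cmp[OF T.category arrow_cmp[OF T.category f \<Phi>h'] Gg])
    \<comment> \<open>The dual of \<open>tensor_transpose_natural\<close> brackets composites the
      opposite way.\<close>
    have b_eq: "?b = cmp S X' X (fobj ?G Y') (cmp S X (fobj ?G Y) (fobj ?G Y') (farr ?G Y Y' g) (\<Phi> X Y h)) f"
      using category_assoc[OF T.category f \<Phi>h' Gg] by simp
    \<comment> \<open>Since \<open>?p\<close> is injective, naturality of \<Phi> may be checked on
      transposes, where no inverse occurs.\<close>
    have "?t X' Y' ?a n k = ?p X' Y' ?b n k" if k: "k \<in> fobj K n" for n k
    proof -
      have v: "?t X Y h n k \<in> fobj (Map S X Y) n"
        using sset_hom_app[OF bij_betw_apply[OF t[OF ob(2,3)] h] k] .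
      have "?t X' Y' ?a n k = Map_post S X' Y Y' g n (Map_pre S X' X Y f n (?t X Y h n k))"
        using T.tensor_transpose_natural[OF f g K K id Farr[OF f] _ k, of h] h ob k by (simp add: F)
      \<comment> \<open>The cylinder side applies S(f,-) first, the path side S(-,g) first; the two
        actions commute.\<close>
      also have "\<dots> = Map_pre S X' X Y' f n (Map_post S X Y Y' g n (?p X Y (\<Phi> X Y h) n k))"
        using T.Map_post_pre[OF f g v] p\<Phi>[OF ob(2,3) h] by simp
      also have "\<dots> = ?p X' Y' ?b n k"
        using P.dual.tensor_transpose_natural[of Y' Y g X X' f K K "sset_id K" "farr ?G Y Y' g" "\<Phi> X Y h" k n]
          f g K id Garr[OF g] \<Phi>h ob k b_eq by (simp add: G)
      finally show ?thesis .
    qed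
    then have "?t X' Y' ?a = ?p X' Y' ?b"
      using sset_hom_eqI bij_betw_apply[OF t[OF ob(1,4)] a] bij_betw_apply[OF p[OF ob(1,4)] b] by blast
    then show ?thesis
      using bij_betw_inv_into_left[OF p[OF ob(1,4)] b] by (simp add: \<Phi>_def)
  qed
  with isF isG \<Phi> show ?thesis
    unfolding left_adjoint_def by blast
qed

theorem theorem1p4:
  fixes U :: "'a set set" and S :: "('o, 'm, 'a) simp_cat"
  assumes "is_simplicial_category U S"
    and "\<forall>X \<in> obj S. \<forall>K \<in> obj (sset_cat U). (\<exists>c. is_cylinder S X K c) \<and> (\<exists>p. is_path S X K p)"
  shows
    "(\<forall>c. cylinder_choice U S c \<longrightarrow> cyl_iso_natural U S c) \<and>
     (\<forall>p. path_choice U S p \<longrightarrow> path_iso_natural U S p) \<and>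
     (\<forall>c p. cylinder_choice U S c \<and> path_choice U S p \<longrightarrow>
        (\<forall>X \<in> obj S.
           left_adjoint (sset_cat U) S
             (fix_fst S (sset_cat U) (tensor U S c) X)
             (fix_fst (op_cat S) S (enr S) X)) \<and>
        (\<forall>X \<in> obj S.
           left_adjoint (sset_cat U) (op_cat S)
             (op_functor (fix_fst S (op_cat (sset_cat U)) (cotensor U S p) X))
             (fix_snd (op_cat S) S (enr S) X)) \<and>
        (\<forall>K \<in> obj (sset_cat U).
           left_adjoint S S
             (fix_snd S (sset_cat U) (tensor U S c) K)
             (fix_snd S (op_cat (sset_cat U)) (cotensor U S p) K)))"
proof -
  interpret simplicial_category U S
    using assms(1) by unfold_locales
  have T: "tensored_category U S c" if "cylinder_choice U S c" for c
    using that by unfold_locales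
  have P: "cotensored_category U S p" if "path_choice U S p" for p
    using that by unfold_locales
  show ?thesis
    using tensored_category.cyl_iso_natural[OF T] cotensored_category.path_iso_natural[OF P]
      tensored_category.tensor_left_adjoint_Map[OF T] cotensored_category.cotensor_left_adjoint_Map[OF P]
      tensor_left_adjoint_cotensor[OF T P]
    by simp
qed

end
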